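(* Let $d\in\mathbb N$, $R>0$, $0<p\le1$, let $\emptyset\neq\mathcal R\subseteq\{Rw+R[0,1]^d: w\in\mathbb Z^d\}$ be a nonempty collection of cubes, let $K=\bigcup_{Q\in\mathcal R}Q$, and let $V$ be the set of all vertices of the cubes in $\mathcal R$ (the cube $Rw+R[0,1]^d$ has vertex set $Rw+R\{0,1\}^d$). Equip $K$ and $V$ with the metric induced by the $\ell_1$ norm $|\cdot|_1$ on $\mathbb R^d$ and fix a point of $V$ as base point. Then there is a unique map $r_{K,V}:(K,|\cdot|_1)\to\mathcal F_p(V,|\cdot|_1)$ such that $r_{K,V}(v)=\delta_V(v)$ for every $v\in V$ and $r_{K,V}$ is coordinatewise affine on each of the cubes in $\mathcal R$. Moreover, writing $C(p,n)=n^{1/p-1}$ for $n\in\mathbb N$, its Lipschitz constant satisfies $$C(p,2^{d-1})\le \operatorname{Lip} r_{K,V}\le C(p,2^{d-1})\,C(p,d)\,C(p,3).$$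
   Context: Vector spaces are real. Lipschitz free $p$-space ($0<p\le1$): for a metric space $(\mathcal M,\sigma)$ with base point $0_{\mathcal M}$, let $\mathcal P(\mathcal M)$ be the vector space with linear basis $\{\delta_{\mathcal M}(x):x\in\mathcal M\setminus\{0_{\mathcal M}\}\}$, and put $\delta_{\mathcal M}(0_{\mathcal M})=0$. For $m\in\mathcal P(\mathcal M)$ let $\|m\|_p=\inf\left(\sum_{i=1}^n|a_i|^p\right)^{1/p}$, the infimum over all finite representations $m=\sum_{i=1}^n a_i\frac{\delta_{\mathcal M}(x_i)-\delta_{\mathcal M}(y_i)}{\sigma(x_i,y_i)}$ with $a_i\in\mathbb R$, $x_i\ne y_i$ in $\mathcal M$. This is a $p$-norm (i.e. positive definite, absolutely homogeneous, and $\|x+y\|^p\le\|x\|^p+\|y\|^p$), and $\mathcal F_p(\mathcal M)$ is the completion of $\mathcal P(\mathcal M)$; $\delta_{\mathcal M}:\mathcal M\to\mathcal F_p(\mathcal M)$ is an isometric embedding. A map on a cube $Q=\prod_{i=1}^d I_i$ into a vector space is coordinatewise affine if it is affine in each coordinate $x_i\in I_i$ separately when the other coordinates are fixed. For a map $f$ from a metric space $(K,\sigma)$ into a $p$-normed space, $\operatorname{Lip} f=\sup_{x\ne y}\|f(x)-f(y)\|/\sigma(x,y)$. *)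

theory Defs
  imports "HOL-Analysis.Analysis"
begin

section \<open>Lipschitz free p-spaces\<close>

text \<open>
  The parameters \<open>\<sigma>\<close>, \<open>M\<close>, \<open>b\<close> below stand for a metric, its carrier and the base point.
  Elements of the space of molecules \<open>\<P>(M)\<close> are represented by their coefficient functions with
  respect to the basis \<open>{\<delta>(x). x \<in> M - {b}}\<close>.
\<close>

definition delta :: "'a \<Rightarrow> 'a \<Rightarrow> 'a \<Rightarrow> real" where
  "delta b x = (\<lambda>z. if z = x \<and> x \<noteq> b then 1 else 0)"

definition molecules :: "'a set \<Rightarrow> 'a \<Rightarrow> ('a \<Rightarrow> real) set" where
  "molecules M b = {m. finite {z. m z \<noteq> 0} \<and> {z. m z \<noteq> 0} \<subseteq> M - {b}}"

definition pnorm ::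
  "real \<Rightarrow> ('a \<Rightarrow> 'a \<Rightarrow> real) \<Rightarrow> 'a set \<Rightarrow> 'a \<Rightarrow> ('a \<Rightarrow> real) \<Rightarrow> real" where
  "pnorm p \<sigma> M b m =
     Inf {(\<Sum>i<n. \<bar>a i\<bar> powr p) powr (1 / p) | (n::nat) a x y.
            (\<forall>i<n. x i \<in> M \<and> y i \<in> M \<and> x i \<noteq> y i) \<and>
            m = (\<lambda>z. \<Sum>i<n. a i * ((delta b (x i) z - delta b (y i) z) / \<sigma> (x i) (y i)))}"

text \<open>
  The completion of \<open>\<P>(M)\<close>: Cauchy sequences of molecules modulo null sequences.
  Vectors of \<open>\<F>\<^sub>p(M)\<close> are thus equivalence classes, and the operations below are meant for
  arguments in \<open>free_p_space p \<sigma> M b\<close> only.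
\<close>

definition cauchy_molecules ::
  "real \<Rightarrow> ('a \<Rightarrow> 'a \<Rightarrow> real) \<Rightarrow> 'a set \<Rightarrow> 'a \<Rightarrow> (nat \<Rightarrow> 'a \<Rightarrow> real) set" where
  "cauchy_molecules p \<sigma> M b =
     {s. (\<forall>n. s n \<in> molecules M b) \<and>
         (\<forall>e>0. \<exists>N. \<forall>m\<ge>N. \<forall>n\<ge>N. pnorm p \<sigma> M b (\<lambda>z. s m z - s n z) < e)}"

definition cauchy_rel ::
  "real \<Rightarrow> ('a \<Rightarrow> 'a \<Rightarrow> real) \<Rightarrow> 'a set \<Rightarrow> 'a \<Rightarrow>
    ((nat \<Rightarrow> 'a \<Rightarrow> real) \<times> (nat \<Rightarrow> 'a \<Rightarrow> real)) set" where
  "cauchy_rel p \<sigma> M b =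
     {(s, t). s \<in> cauchy_molecules p \<sigma> M b \<and> t \<in> cauchy_molecules p \<sigma> M b \<and>
              (\<lambda>n. pnorm p \<sigma> M b (\<lambda>z. s n z - t n z)) \<longlonglongrightarrow> 0}"

type_synonym 'a free_vec = "(nat \<Rightarrow> 'a \<Rightarrow> real) set"

definition free_p_space ::
  "real \<Rightarrow> ('a \<Rightarrow> 'a \<Rightarrow> real) \<Rightarrow> 'a set \<Rightarrow> 'a \<Rightarrow> 'a free_vec set" where
  "free_p_space p \<sigma> M b = cauchy_molecules p \<sigma> M b // cauchy_rel p \<sigma> M b"

definition free_add ::
  "real \<Rightarrow> ('a \<Rightarrow> 'a \<Rightarrow> real) \<Rightarrow> 'a set \<Rightarrow> 'a \<Rightarrow> 'a free_vec \<Rightarrow> 'a free_vec \<Rightarrow> 'a free_vec" where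
  "free_add p \<sigma> M b X Y =
     (\<Union>s\<in>X. \<Union>t\<in>Y. cauchy_rel p \<sigma> M b `` {\<lambda>n z. s n z + t n z})"

definition free_scale ::
  "real \<Rightarrow> ('a \<Rightarrow> 'a \<Rightarrow> real) \<Rightarrow> 'a set \<Rightarrow> 'a \<Rightarrow> real \<Rightarrow> 'a free_vec \<Rightarrow> 'a free_vec" where
  "free_scale p \<sigma> M b c X = (\<Union>s\<in>X. cauchy_rel p \<sigma> M b `` {\<lambda>n z. c * s n z})"

definition free_diff ::
  "real \<Rightarrow> ('a \<Rightarrow> 'a \<Rightarrow> real) \<Rightarrow> 'a set \<Rightarrow> 'a \<Rightarrow> 'a free_vec \<Rightarrow> 'a free_vec \<Rightarrow> 'a free_vec" where
  "free_diff p \<sigma> M b X Y = free_add p \<sigma> M b X (free_scale p \<sigma> M b (- 1) Y)"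

definition free_norm ::
  "real \<Rightarrow> ('a \<Rightarrow> 'a \<Rightarrow> real) \<Rightarrow> 'a set \<Rightarrow> 'a \<Rightarrow> 'a free_vec \<Rightarrow> real" where
  "free_norm p \<sigma> M b X = (THE l. \<forall>s\<in>X. (\<lambda>n. pnorm p \<sigma> M b (s n)) \<longlonglongrightarrow> l)"

definition free_delta ::
  "real \<Rightarrow> ('a \<Rightarrow> 'a \<Rightarrow> real) \<Rightarrow> 'a set \<Rightarrow> 'a \<Rightarrow> 'a \<Rightarrow> 'a free_vec" where
  "free_delta p \<sigma> M b x = cauchy_rel p \<sigma> M b `` {\<lambda>n. delta b x}"

text \<open>
  Lipschitz constant of \<open>f : (K, \<sigma>) \<rightarrow> \<F>\<^sub>p(M, \<sigma>)\<close>. It is an extended real, so that an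
  upper bound by a real number includes the assertion that \<open>f\<close> is Lipschitz.
\<close>

definition free_Lip ::
  "real \<Rightarrow> ('a \<Rightarrow> 'a \<Rightarrow> real) \<Rightarrow> 'a set \<Rightarrow> 'a \<Rightarrow> 'a set \<Rightarrow> ('a \<Rightarrow> 'a free_vec) \<Rightarrow> ereal" where
  "free_Lip p \<sigma> M b K f =
     (SUP (x, y) \<in> {(x, y). x \<in> K \<and> y \<in> K \<and> x \<noteq> y}.
        ereal (free_norm p \<sigma> M b (free_diff p \<sigma> M b (f x) (f y)) / \<sigma> x y))"


section \<open>Cubes and coordinatewise affine maps\<close>

definition l1_dist :: "real ^ 'n \<Rightarrow> real ^ 'n \<Rightarrow> real" where
  "l1_dist x y = (\<Sum>i\<in>UNIV. \<bar>x $ i - y $ i\<bar>)"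

definition grid_cube :: "real \<Rightarrow> int ^ 'n \<Rightarrow> (real ^ 'n) set" where
  "grid_cube R w = {\<chi> i. R * of_int (w $ i) + R * t $ i | t. \<forall>i. t $ i \<in> {0..1}}"

definition grid_cube_vertices :: "real \<Rightarrow> int ^ 'n \<Rightarrow> (real ^ 'n) set" where
  "grid_cube_vertices R w = {\<chi> i. R * of_int (w $ i) + R * t $ i | t. \<forall>i. t $ i \<in> {0, 1}}"

definition vertices_of :: "real \<Rightarrow> (real ^ 'n) set set \<Rightarrow> (real ^ 'n) set" where
  "vertices_of R \<R> = (\<Union>w \<in> {w. grid_cube R w \<in> \<R>}. grid_cube_vertices R w)"

definition coordinatewise_affine_on ::
  "('f \<Rightarrow> 'f \<Rightarrow> 'f) \<Rightarrow> (real \<Rightarrow> 'f \<Rightarrow> 'f) \<Rightarrow> (real ^ 'n) set \<Rightarrow> (real ^ 'n \<Rightarrow> 'f) \<Rightarrow> bool" where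
  "coordinatewise_affine_on plus_F scale_F Q f \<longleftrightarrow>
     (\<forall>i. \<forall>x\<in>Q. \<forall>y\<in>Q. (\<forall>j. j \<noteq> i \<longrightarrow> x $ j = y $ j) \<longrightarrow>
        (\<forall>t\<in>{0..1}. f ((1 - t) *\<^sub>R x + t *\<^sub>R y) =
           plus_F (scale_F (1 - t) (f x)) (scale_F t (f y))))"

text \<open>
  Maps on \<open>K\<close> are taken to be extensional (\<open>\<rightarrow>\<^sub>E\<close>), so that uniqueness of such an \<open>r\<close> means
  uniqueness on \<open>K\<close>.
\<close>

definition is_vertex_interpolation ::
  "real \<Rightarrow> (real ^ 'n) set \<Rightarrow> real ^ 'n \<Rightarrow> (real ^ 'n) set \<Rightarrow> (real ^ 'n) set set \<Rightarrow>
    (real ^ 'n \<Rightarrow> (real ^ 'n) free_vec) \<Rightarrow> bool" where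
  "is_vertex_interpolation p V b K \<R> r \<longleftrightarrow>
     r \<in> K \<rightarrow>\<^sub>E free_p_space p l1_dist V b \<and>
     (\<forall>v\<in>V. r v = free_delta p l1_dist V b v) \<and>
     (\<forall>Q\<in>\<R>. coordinatewise_affine_on (free_add p l1_dist V b) (free_scale p l1_dist V b) Q r)"

definition C_const :: "real \<Rightarrow> nat \<Rightarrow> real" where
  "C_const p n = real n powr (1 / p - 1)"

end

theory Submission imports Defs begin

text \<open>
  The interpolation is \<open>x \<mapsto> \<Sum>v\<in>V. (\<Prod>i. max 0 (1 - |x\<^sub>i - v\<^sub>i| / R)) \<delta>(v)\<close>, a product of hat functions,
  so it takes its values in the molecules and is consistent on overlapping cubes.

  Upper bound: consider two points, each in its own cube, that agree in the coordinates of a set \<open>S\<close>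
  shared by the two cubes and are at vertex positions in all others. Splitting along one coordinate of
  \<open>S\<close> at a time costs a factor \<open>t\<^sup>p + (1 - t)\<^sup>p \<le> 2\<^sup>1\<^sup>-\<^sup>p\<close> in the \<open>p\<close>-th power of the norm, and the
  leaves are differences of Dirac masses. With \<open>d - 1\<close> such coordinates this controls one coordinate
  step inside a cube and the jump between facing points of two different cubes. A path in a cube has
  \<open>d\<close> such steps, and two points of \<open>K\<close> are joined by an \<open>\<ell>\<^sub>1\<close>-geodesic made of a path in the first
  cube, a jump, and a path in the second cube.

  Lower bound: the images of the centres of two opposite facets differ by a molecule with coefficients
  \<open>\<plusminus> 2\<^sup>1\<^sup>-\<^sup>d\<close> at the \<open>2\<^sup>d\<close> vertices of a cube. As distinct points of \<open>V\<close> are at distance at least \<open>R\<close>,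
  the \<open>\<ell>\<^sub>p\<close> norm of the coefficients bounds its norm from below.
\<close>

section \<open>Inequalities for powers\<close>

text \<open>After division by \<open>s = x + y\<close> both terms lie in [0,1], where a number is at
  most its \<open>p\<close>-th power; the two quotients add up to 1.\<close>

lemma powr_add_le:
  fixes x y p :: real
  assumes "0 \<le> x" "0 \<le> y" "0 < p" "p \<le> 1"
  shows "(x + y) powr p \<le> x powr p + y powr p"
proof (cases "x + y = 0")
  case True
  then show ?thesis using assms by simp
next
  case False
  define s where "s = x + y"
  have s: "s > 0" using False assms by (simp add: s_def)
  have le: "u / s \<le> u powr p / s powr p" if "0 \<le> u" "u \<le> s" for u
    using powr_mono'[of p 1 "u / s"] that s assms by (simp add: powr_divide)
  have "1 = x / s + y / s" using s by (simp add: s_def flip: add_divide_distrib)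
  also have "\<dots> \<le> x powr p / s powr p + y powr p / s powr p"
    using assms by (intro add_mono le) (auto simp: s_def)
  finally show ?thesis using s by (simp add: s_def field_simps)
qed

lemma abs_sum_powr_le:
  fixes u :: "'b \<Rightarrow> real"
  assumes "0 < p" "p \<le> 1"
  shows "\<bar>sum u S\<bar> powr p \<le> (\<Sum>i\<in>S. \<bar>u i\<bar> powr p)"
proof (induction S rule: infinite_finite_induct)
  case (insert i S)
  have "\<bar>u i + sum u S\<bar> powr p \<le> (\<bar>u i\<bar> + \<bar>sum u S\<bar>) powr p"
    using assms by (intro powr_mono2) auto
  also have "\<dots> \<le> \<bar>u i\<bar> powr p + \<bar>sum u S\<bar> powr p"
    using assms by (intro powr_add_le) auto
  finally show ?case using insert by simp
qed (use assms in auto)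

text \<open>This inequality produces each of the constants 2, \<open>d\<close> and 3 to the power
  \<open>1 - p\<close> in the upper bound. Young's inequality is applied to every \<open>u i\<close>
  against the mean \<open>a\<close>; summed over \<open>S\<close>, the right-hand sides give exactly
  the total \<open>T\<close>.\<close>

lemma sum_powr_le:
  fixes u :: "'b \<Rightarrow> real"
  assumes "finite S" "\<And>i. i \<in> S \<Longrightarrow> 0 \<le> u i" "0 < p" "p \<le> 1"
  shows "(\<Sum>i\<in>S. u i powr p) \<le> real (card S) powr (1 - p) * sum u S powr p"
proof (cases "sum u S = 0")
  case True
  then have "u i = 0" if "i \<in> S" for i
    using that assms(1,2) sum_nonneg_eq_0_iff by blast
  then show ?thesis by simp
next
  case False
  define T where "T = sum u S"
  define a where "a = T / card S"
  have T: "T > 0" using False sum_nonneg[of S u] assms(2) by (simp add: T_def less_le)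
  have n: "real (card S) > 0" using False assms(1) by (auto simp: card_gt_0_iff)
  have a: "a > 0" using T n by (simp add: a_def)
  have "u i powr p * a powr (1 - p) \<le> p * u i + (1 - p) * a" if "i \<in> S" for i
  proof (cases "u i = 0")
    case True
    then show ?thesis using a assms by simp
  next
    case False
    then show ?thesis using assms a that by (intro Youngs_inequality_0) (auto simp: less_le)
  qed
  then have "(\<Sum>i\<in>S. u i powr p * a powr (1 - p)) \<le> (\<Sum>i\<in>S. p * u i + (1 - p) * a)"
    by (rule sum_mono)
  also have "\<dots> = p * T + (1 - p) * T"
    using n by (simp add: sum.distrib T_def a_def flip: sum_distrib_left)
  finally have "(\<Sum>i\<in>S. u i powr p) * a powr (1 - p) \<le> T"
    unfolding sum_distrib_right by (simp add: left_diff_distrib)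
  then have "(\<Sum>i\<in>S. u i powr p) \<le> T / a powr (1 - p)"
    using a by (simp add: pos_le_divide_eq)
  also have "\<dots> = real (card S) powr (1 - p) * (T powr 1 / T powr (1 - p))"
    using T n by (simp add: a_def powr_divide)
  also have "T powr 1 / T powr (1 - p) = T powr p"
    unfolding powr_diff[symmetric] by simp
  finally show ?thesis by (simp add: T_def)
qed


section \<open>The p-norm on molecules and classes of constant sequences\<close>

lemma sum_lessThan_add: "(\<Sum>i<n + k. f i) = (\<Sum>i<n. f i) + (\<Sum>i<k. f (n + i))" for f :: "nat \<Rightarrow> 'a :: comm_monoid_add"
  by (induction k) (simp_all add: add.assoc)

section \<open>Representations of molecules and subadditivity of the \<open>p\<close>-th power of
  the norm\<close>

locale p_molecules =
  fixes p :: real and \<sigma> :: "'a \<Rightarrow> 'a \<Rightarrow> real" and M :: "'a set" and b :: 'a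
  assumes p_pos: "0 < p" and p_le_1: "p \<le> 1" and base_in: "b \<in> M"
    and dist_pos: "\<And>x y. x \<in> M \<Longrightarrow> y \<in> M \<Longrightarrow> x \<noteq> y \<Longrightarrow> 0 < \<sigma> x y"
begin

abbreviation "N \<equiv> pnorm p \<sigma> M b"
abbreviation "Mol \<equiv> molecules M b"

text \<open>The condition under the infimum in \<open>pnorm\<close>, isolated so that
  representations can be concatenated and rescaled.\<close>

definition rep :: "('a \<Rightarrow> real) \<Rightarrow> nat \<Rightarrow> (nat \<Rightarrow> real) \<Rightarrow> (nat \<Rightarrow> 'a) \<Rightarrow> (nat \<Rightarrow> 'a) \<Rightarrow> bool" where
  "rep m n a x y \<longleftrightarrow> (\<forall>i<n. x i \<in> M \<and> y i \<in> M \<and> x i \<noteq> y i) \<and>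
     m = (\<lambda>z. \<Sum>i<n. a i * ((delta b (x i) z - delta b (y i) z) / \<sigma> (x i) (y i)))"

lemma N_eq: "N m = Inf {(\<Sum>i<n. \<bar>a i\<bar> powr p) powr (1 / p) | (n::nat) a x y. rep m n a x y}"
  unfolding pnorm_def rep_def ..

lemma powr_inverse_p: "0 \<le> c \<Longrightarrow> (c powr (1 / p)) powr p = c" "0 \<le> c \<Longrightarrow> (c powr p) powr (1 / p) = c"
  using p_pos by (auto simp: powr_powr)

lemma powr_p_le_cancel: "0 \<le> v \<Longrightarrow> u powr p \<le> v powr p \<Longrightarrow> u \<le> v"
  using p_pos by (meson powr_less_mono2 not_le)

lemma pnorm_nonneg:
  assumes "rep m n a x y" shows "0 \<le> N m"
  unfolding N_eq using assms by (intro cInf_greatest) auto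

text \<open>All estimates are made for the \<open>p\<close>-th power of the norm, the quantity that
  is subadditive; here the outer exponent \<open>1 / p\<close> is removed.\<close>

lemma pnorm_powr_le:
  assumes "rep m n a x y" shows "N m powr p \<le> (\<Sum>i<n. \<bar>a i\<bar> powr p)"
proof -
  have "N m \<le> (\<Sum>i<n. \<bar>a i\<bar> powr p) powr (1 / p)"
    unfolding N_eq using assms by (intro cInf_lower bdd_belowI[of _ 0]) auto
  then have "N m powr p \<le> ((\<Sum>i<n. \<bar>a i\<bar> powr p) powr (1 / p)) powr p"
    using pnorm_nonneg[OF assms] p_pos by (intro powr_mono2) auto
  then show ?thesis
    by (simp add: powr_inverse_p(1) sum_nonneg)
qed

text \<open>Every atom is paired with the base point, whose \<open>delta\<close> vanishes. The
  infimum defining the norm of a molecule is thus taken over a nonempty set.\<close>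

lemma Mol_rep:
  assumes "m \<in> Mol" obtains n a x y where "rep m n a x y"
proof -
  let ?A = "{z. m z \<noteq> 0}"
  have fin: "finite ?A" and sub: "?A \<subseteq> M - {b}"
    using assms by (auto simp: molecules_def)
  obtain h where h: "bij_betw h {0..<card ?A} ?A"
    using ex_bij_betw_nat_finite[OF fin] by blast
  have h': "bij_betw h {..<card ?A} ?A"
    using h by (simp add: atLeast0LessThan)
  have hA: "h i \<in> M - {b}" if "i < card ?A" for i
    using that h' sub by (auto simp: bij_betw_def)
  have "m z = (\<Sum>i<card ?A. (m (h i) * \<sigma> (h i) b) * ((delta b (h i) z - delta b b z) / \<sigma> (h i) b))" for z
  proof -
    have "(\<Sum>i<card ?A. (m (h i) * \<sigma> (h i) b) * ((delta b (h i) z - delta b b z) / \<sigma> (h i) b))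
        = (\<Sum>i<card ?A. m (h i) * delta b (h i) z)"
    proof (intro sum.cong refl)
      fix i assume "i \<in> {..<card ?A}"
      then have "\<sigma> (h i) b > 0"
        using hA[of i] base_in by (intro dist_pos) auto
      then show "(m (h i) * \<sigma> (h i) b) * ((delta b (h i) z - delta b b z) / \<sigma> (h i) b) = m (h i) * delta b (h i) z"
        by (simp add: delta_def)
    qed
    also have "\<dots> = (\<Sum>u\<in>?A. m u * delta b u z)"
      using sum.reindex_bij_betw[OF h', of "\<lambda>u. m u * delta b u z"] .
    also have "\<dots> = (\<Sum>u\<in>?A. if z = u then m u else 0)"
      using sub by (intro sum.cong) (auto simp: delta_def)
    also have "\<dots> = m z"
      using fin by (simp add: sum.delta)
    finally show ?thesis by simp
  qed
  then have "m = (\<lambda>z. \<Sum>i<card ?A. (m (h i) * \<sigma> (h i) b) * ((delta b (h i) z - delta b b z) / \<sigma> (h i) b))"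
    by (rule ext)
  moreover have "\<forall>i<card ?A. h i \<in> M \<and> b \<in> M \<and> h i \<noteq> b"
    using hA base_in by blast
  ultimately have "rep m (card ?A) (\<lambda>i. m (h i) * \<sigma> (h i) b) h (\<lambda>i. b)"
    unfolding rep_def by (intro conjI)
  then show ?thesis by (rule that)
qed

lemma pnorm_ge_0: "m \<in> Mol \<Longrightarrow> 0 \<le> N m"
  by (meson Mol_rep pnorm_nonneg)

lemma pnorm_powr_approx:
  assumes "m \<in> Mol" "e > 0"
  obtains n a x y where "rep m n a x y" "(\<Sum>i<n. \<bar>a i\<bar> powr p) < N m powr p + e"
proof -
  let ?S = "{(\<Sum>i<n. \<bar>a i\<bar> powr p) powr (1 / p) | (n::nat) a x y. rep m n a x y}"
  have ne: "?S \<noteq> {}"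
    by (rule Mol_rep[OF assms(1)]) blast
  have "N m = (N m powr p) powr (1/p)"
    using pnorm_ge_0[OF assms(1)] by (simp add: powr_inverse_p)
  also have "\<dots> < (N m powr p + e) powr (1/p)"
    using assms(2) p_pos by (intro powr_less_mono2) auto
  finally obtain s where "s \<in> ?S" "s < (N m powr p + e) powr (1/p)"
    unfolding N_eq[of m] using cInf_lessD[OF ne] by meson
  then obtain n a x y where r: "rep m n a x y"
    and *: "(\<Sum>i<n. \<bar>a i\<bar> powr p) powr (1 / p) < (N m powr p + e) powr (1/p)"
    by blast
  have "(\<Sum>i<n. \<bar>a i\<bar> powr p) < N m powr p + e"
    using powr_less_mono2[OF p_pos _ *] assms(2) by (simp add: powr_inverse_p sum_nonneg add_nonneg_nonneg)
  with r show ?thesis by (rule that)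
qed

lemma Mol_add: "m \<in> Mol \<Longrightarrow> m' \<in> Mol \<Longrightarrow> (\<lambda>z. m z + m' z) \<in> Mol"
proof -
  assume "m \<in> Mol" "m' \<in> Mol"
  moreover have "{z. m z + m' z \<noteq> 0} \<subseteq> {z. m z \<noteq> 0} \<union> {z. m' z \<noteq> 0}" by auto
  ultimately show ?thesis
    unfolding molecules_def by (blast intro: finite_subset[OF _ finite_UnI])
qed

lemma Mol_scale: "m \<in> Mol \<Longrightarrow> (\<lambda>z. c * m z) \<in> Mol"
  unfolding molecules_def by (auto intro: finite_subset[of _ "{z. m z \<noteq> 0}"])

lemma Mol_diff: "m \<in> Mol \<Longrightarrow> m' \<in> Mol \<Longrightarrow> (\<lambda>z. m z - m' z) \<in> Mol"
  using Mol_add[OF _ Mol_scale[of m' "-1"], of m] by simp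

text \<open>Concatenation of two representations, the second one shifted by
  \<open>n\<close>.\<close>

lemma rep_add:
  assumes "rep m n a x y" "rep m' n' a' x' y'"
  shows "rep (\<lambda>z. m z + m' z) (n + n') (\<lambda>i. if i < n then a i else a' (i - n))
    (\<lambda>i. if i < n then x i else x' (i - n)) (\<lambda>i. if i < n then y i else y' (i - n))"
  using assms unfolding rep_def by (auto simp: sum_lessThan_add)

lemma pnorm_powr_add:
  assumes "m \<in> Mol" "m' \<in> Mol"
  shows "N (\<lambda>z. m z + m' z) powr p \<le> N m powr p + N m' powr p"
proof (rule field_le_epsilon)
  fix e :: real assume "e > 0"
  then have "e/2 > 0" by simp
  obtain n a x y where r: "rep m n a x y" "(\<Sum>i<n. \<bar>a i\<bar> powr p) < N m powr p + e/2"
    using pnorm_powr_approx[OF assms(1) \<open>e/2 > 0\<close>] .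
  obtain n' a' x' y' where r': "rep m' n' a' x' y'" "(\<Sum>i<n'. \<bar>a' i\<bar> powr p) < N m' powr p + e/2"
    using pnorm_powr_approx[OF assms(2) \<open>e/2 > 0\<close>] .
  show "N (\<lambda>z. m z + m' z) powr p \<le> N m powr p + N m' powr p + e"
    using pnorm_powr_le[OF rep_add[OF r(1) r'(1)]] r(2) r'(2) by (simp add: sum_lessThan_add)
qed

lemma pnorm_powr_scale_le:
  assumes "m \<in> Mol"
  shows "N (\<lambda>z. c * m z) powr p \<le> \<bar>c\<bar> powr p * N m powr p"
proof (cases "c = 0")
  case True
  \<comment> \<open>The zero molecule has the empty representation, of cost 0.\<close>
  have "rep (\<lambda>z. c * m z) 0 (\<lambda>_. 0) (\<lambda>_. b) (\<lambda>_. b)"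
    using True by (simp add: rep_def)
  from pnorm_powr_le[OF this] True show ?thesis by simp
next
  case False
  have "N (\<lambda>z. c * m z) powr p / \<bar>c\<bar> powr p \<le> N m powr p"
  proof (rule field_le_epsilon)
    fix e :: real assume "e > 0"
    obtain n a x y where r: "rep m n a x y" "(\<Sum>i<n. \<bar>a i\<bar> powr p) < N m powr p + e"
      using pnorm_powr_approx[OF assms \<open>e > 0\<close>] .
    have "rep (\<lambda>z. c * m z) n (\<lambda>i. c * a i) x y"
      using r(1) by (auto simp: rep_def sum_distrib_left mult.assoc)
    then have "N (\<lambda>z. c * m z) powr p \<le> \<bar>c\<bar> powr p * (\<Sum>i<n. \<bar>a i\<bar> powr p)"
      using pnorm_powr_le by (fastforce simp: abs_mult powr_mult sum_distrib_left)
    also have "\<dots> \<le> \<bar>c\<bar> powr p * (N m powr p + e)"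
      using r(2) by (intro mult_left_mono) auto
    finally show "N (\<lambda>z. c * m z) powr p / \<bar>c\<bar> powr p \<le> N m powr p + e"
      using False by (simp add: field_simps)
  qed
  then show ?thesis using False by (simp add: field_simps)
qed

lemma pnorm_minus_commute:
  assumes "m \<in> Mol" "m' \<in> Mol"
  shows "N (\<lambda>z. m z - m' z) = N (\<lambda>z. m' z - m z)"
proof -
  have le: "N (\<lambda>z. m z - m' z) \<le> N (\<lambda>z. m' z - m z)" if "m \<in> Mol" "m' \<in> Mol" for m m'
  proof -
    have "N (\<lambda>z. m z - m' z) powr p \<le> N (\<lambda>z. m' z - m z) powr p"
      using pnorm_powr_scale_le[OF Mol_diff[OF that(2,1)], of "-1"] by simp
    then show ?thesis
      using pnorm_ge_0[OF Mol_diff] that p_pos by (meson powr_less_mono2 not_le)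
  qed
  show ?thesis using le assms by (meson antisym)
qed

text \<open>A single term with coefficient \<open>\<sigma> x y\<close> represents the difference.
  The case \<open>x = y\<close> uses the empty representation and also supplies the norm of the zero
  molecule.\<close>

lemma pnorm_delta_diff:
  assumes "x \<in> M" "y \<in> M"
  shows "N (\<lambda>z. delta b x z - delta b y z) powr p \<le> (if x = y then 0 else \<sigma> x y powr p)"
proof (cases "x = y")
  case True
  have "rep (\<lambda>z. 0) 0 (\<lambda>_. 0) (\<lambda>_. b) (\<lambda>_. b)"
    by (simp add: rep_def)
  from pnorm_powr_le[OF this] True show ?thesis by simp
next
  case False
  then have "rep (\<lambda>z. delta b x z - delta b y z) 1 (\<lambda>_. \<sigma> x y) (\<lambda>_. x) (\<lambda>_. y)"
    using assms dist_pos[OF assms] by (auto simp: rep_def)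
  from pnorm_powr_le[OF this] False dist_pos[OF assms] show ?thesis by simp
qed

lemma tendsto_0_powr_iff:
  assumes "\<And>n. 0 \<le> f n"
  shows "f \<longlonglongrightarrow> 0 \<longleftrightarrow> (\<lambda>n::nat. f n powr p) \<longlonglongrightarrow> 0"
proof
  assume "f \<longlonglongrightarrow> 0"
  then show "(\<lambda>n. f n powr p) \<longlonglongrightarrow> 0"
    using tendsto_powr'[of f 0 sequentially "\<lambda>_. p" p] assms p_pos by auto
next
  assume "(\<lambda>n. f n powr p) \<longlonglongrightarrow> 0"
  then have "(\<lambda>n. (f n powr p) powr (1/p)) \<longlonglongrightarrow> 0"
    using tendsto_powr'[of "\<lambda>n. f n powr p" 0 sequentially "\<lambda>_. 1/p" "1/p"] assms p_pos by auto
  then show "f \<longlonglongrightarrow> 0" using assms by (simp add: powr_inverse_p)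
qed

lemma pnorm_null_powr_iff:
  assumes "\<And>n. u n \<in> Mol"
  shows "(\<lambda>n. N (u n)) \<longlonglongrightarrow> 0 \<longleftrightarrow> (\<lambda>n. N (u n) powr p) \<longlonglongrightarrow> 0"
  by (rule tendsto_0_powr_iff[OF pnorm_ge_0[OF assms]])

lemma null_add:
  assumes "\<And>n. u n \<in> Mol" "\<And>n. v n \<in> Mol" "(\<lambda>n. N (u n)) \<longlonglongrightarrow> 0" "(\<lambda>n. N (v n)) \<longlonglongrightarrow> 0"
  shows "(\<lambda>n. N (\<lambda>z. u n z + v n z)) \<longlonglongrightarrow> 0"
proof -
  have "(\<lambda>n. N (u n) powr p) \<longlonglongrightarrow> 0"
    using assms(1,3) by (rule iffD1[OF pnorm_null_powr_iff])
  moreover have "(\<lambda>n. N (v n) powr p) \<longlonglongrightarrow> 0"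
    using assms(2,4) by (rule iffD1[OF pnorm_null_powr_iff])
  ultimately have "(\<lambda>n. N (u n) powr p + N (v n) powr p) \<longlonglongrightarrow> 0 + 0"
    by (rule tendsto_add)
  then have lim: "(\<lambda>n. N (u n) powr p + N (v n) powr p) \<longlonglongrightarrow> 0" by simp
  have "norm (N (\<lambda>z. u n z + v n z) powr p) \<le> N (u n) powr p + N (v n) powr p" for n
    using pnorm_powr_add[OF assms(1)[of n] assms(2)[of n]] by simp
  then have "(\<lambda>n. N (\<lambda>z. u n z + v n z) powr p) \<longlonglongrightarrow> 0"
    by (intro Lim_null_comparison[OF always_eventually lim]) blast
  then show ?thesis
    by (rule iffD2[OF pnorm_null_powr_iff[OF Mol_add[OF assms(1,2)]]])
qed

lemma null_scale:
  assumes "\<And>n. u n \<in> Mol" "(\<lambda>n. N (u n)) \<longlonglongrightarrow> 0"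
  shows "(\<lambda>n. N (\<lambda>z. c * u n z)) \<longlonglongrightarrow> 0"
proof -
  have "(\<lambda>n. N (u n) powr p) \<longlonglongrightarrow> 0"
    using assms by (rule iffD1[OF pnorm_null_powr_iff])
  then have lim: "(\<lambda>n. \<bar>c\<bar> powr p * N (u n) powr p) \<longlonglongrightarrow> 0"
    by (rule tendsto_mult_right_zero)
  have "norm (N (\<lambda>z. c * u n z) powr p) \<le> \<bar>c\<bar> powr p * N (u n) powr p" for n
    using pnorm_powr_scale_le[OF assms(1)[of n]] by simp
  then have "(\<lambda>n. N (\<lambda>z. c * u n z) powr p) \<longlonglongrightarrow> 0"
    by (intro Lim_null_comparison[OF always_eventually lim]) blast
  then show ?thesis
    by (rule iffD2[OF pnorm_null_powr_iff[OF Mol_scale[OF assms(1)]]])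
qed

section \<open>Molecules inside the completion, as classes of constant sequences\<close>

definition cls :: "('a \<Rightarrow> real) \<Rightarrow> 'a free_vec" where
  "cls m = cauchy_rel p \<sigma> M b `` {\<lambda>n. m}"

definition converges :: "(nat \<Rightarrow> 'a \<Rightarrow> real) \<Rightarrow> ('a \<Rightarrow> real) \<Rightarrow> bool" where
  "converges s m \<longleftrightarrow> (\<forall>n. s n \<in> Mol) \<and> (\<lambda>n. N (\<lambda>z. m z - s n z)) \<longlonglongrightarrow> 0"

lemma converges_Mol: "converges s m \<Longrightarrow> s n \<in> Mol"
  unfolding converges_def by (elim conjE allE)

lemma converges_null: "converges s m \<Longrightarrow> (\<lambda>n. N (\<lambda>z. m z - s n z)) \<longlonglongrightarrow> 0"
  unfolding converges_def by (elim conjE)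

lemma convergesI:
  assumes "\<And>n. s n \<in> Mol" "(\<lambda>n. N (\<lambda>z. m z - s n z)) \<longlonglongrightarrow> 0" shows "converges s m"
  unfolding converges_def using assms by (intro conjI allI)

lemma converges_Cauchy:
  assumes "m \<in> Mol" "converges s m" shows "s \<in> cauchy_molecules p \<sigma> M b"
proof -
  note s = converges_Mol[OF assms(2)]
  have lim: "(\<lambda>n. N (\<lambda>z. m z - s n z) powr p) \<longlonglongrightarrow> 0"
    by (rule iffD1[OF pnorm_null_powr_iff[OF Mol_diff[OF assms(1) s]] converges_null[OF assms(2)]])
  have "\<exists>N0. \<forall>k\<ge>N0. \<forall>n\<ge>N0. N (\<lambda>z. s k z - s n z) < e" if "e > 0" for e
  proof -
    have "e powr p / 2 > 0" using that by simp
    then obtain N0 where N0: "\<And>n. n \<ge> N0 \<Longrightarrow> N (\<lambda>z. m z - s n z) powr p < e powr p / 2"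
      using order_tendstoD(2)[OF lim] unfolding eventually_sequentially by meson
    have "N (\<lambda>z. s k z - s n z) < e" if "k \<ge> N0" "n \<ge> N0" for k n
    proof -
      have "N (\<lambda>z. s k z - s n z) powr p \<le> N (\<lambda>z. s k z - m z) powr p + N (\<lambda>z. m z - s n z) powr p"
        using pnorm_powr_add[OF Mol_diff[OF s[of k] assms(1)] Mol_diff[OF assms(1) s[of n]]] by simp
      also have "\<dots> < e powr p"
        using N0[OF that(1)] N0[OF that(2)] pnorm_minus_commute[OF assms(1) s[of k]] by simp
      finally show ?thesis
        using p_pos \<open>e > 0\<close> by (meson powr_mono2 not_le less_imp_le)
    qed
    then show ?thesis by blast
  qed
  then show ?thesis using s by (simp add: cauchy_molecules_def)
qed

lemma converges_const: "m \<in> Mol \<Longrightarrow> converges (\<lambda>n. m) m"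
  using pnorm_delta_diff[OF base_in base_in] pnorm_ge_0[of "\<lambda>z. 0"]
  by (auto simp: converges_def molecules_def)

text \<open>By subadditivity, the sequences equivalent to one with limit \<open>m\<close> are
  precisely the sequences of molecules with limit \<open>m\<close>. Operations on such a class can
  therefore be computed on any representative.\<close>

lemma cls_converges:
  assumes m: "m \<in> Mol" and s: "converges s m"
  shows "cauchy_rel p \<sigma> M b `` {s} = {t. converges t m}"
proof -
  note sM = converges_Mol[OF s]
  have "(s, t) \<in> cauchy_rel p \<sigma> M b \<longleftrightarrow> converges t m" for t
  proof
    assume "(s, t) \<in> cauchy_rel p \<sigma> M b"
    then have t: "\<And>n. t n \<in> Mol" and lim: "(\<lambda>n. N (\<lambda>z. s n z - t n z)) \<longlonglongrightarrow> 0"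
      unfolding cauchy_rel_def cauchy_molecules_def by blast+
    show "converges t m"
      using null_add[OF Mol_diff[OF m sM] Mol_diff[OF sM t] converges_null[OF s] lim]
      by (intro convergesI t) simp
  next
    assume t: "converges t m"
    note tM = converges_Mol[OF this]
    have "(\<lambda>n. N (\<lambda>z. s n z - m z)) \<longlonglongrightarrow> 0"
      using converges_null[OF s] unfolding pnorm_minus_commute[OF sM m] .
    from null_add[OF Mol_diff[OF sM m] Mol_diff[OF m tM] this converges_null[OF t]]
    have "(\<lambda>n. N (\<lambda>z. s n z - t n z)) \<longlonglongrightarrow> 0" by simp
    then show "(s, t) \<in> cauchy_rel p \<sigma> M b"
      unfolding cauchy_rel_def using converges_Cauchy[OF m s] converges_Cauchy[OF m t] by blast
  qed
  then show ?thesis by auto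
qed

lemma cls_eq: "m \<in> Mol \<Longrightarrow> cls m = {t. converges t m}"
  unfolding cls_def by (rule cls_converges[OF _ converges_const])

lemma free_add_cls:
  assumes "m \<in> Mol" "m' \<in> Mol"
  shows "free_add p \<sigma> M b (cls m) (cls m') = cls (\<lambda>z. m z + m' z)"
proof -
  have "cauchy_rel p \<sigma> M b `` {\<lambda>n z. s n z + t n z} = cls (\<lambda>z. m z + m' z)"
    if "converges s m" "converges t m'" for s t
  proof -
    note st = converges_Mol[OF that(1)] converges_Mol[OF that(2)]
    have "converges (\<lambda>n z. s n z + t n z) (\<lambda>z. m z + m' z)"
      using null_add[OF Mol_diff[OF assms(1) st(1)] Mol_diff[OF assms(2) st(2)]
          converges_null[OF that(1)] converges_null[OF that(2)]]
      by (intro convergesI Mol_add st) (simp add: algebra_simps)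
    then show ?thesis
      using cls_converges cls_eq Mol_add[OF assms] by blast
  qed
  \<comment> \<open>All members of the union in \<open>free_add\<close> coincide; the constant
    sequences show that the union is not empty.\<close>
  moreover have "converges (\<lambda>n. m) m" "converges (\<lambda>n. m') m'"
    using assms converges_const by auto
  ultimately show ?thesis
    unfolding free_add_def cls_eq[OF assms(1)] cls_eq[OF assms(2)] by blast
qed

lemma free_scale_cls:
  assumes "m \<in> Mol"
  shows "free_scale p \<sigma> M b c (cls m) = cls (\<lambda>z. c * m z)"
proof -
  have "cauchy_rel p \<sigma> M b `` {\<lambda>n z. c * s n z} = cls (\<lambda>z. c * m z)"
    if "converges s m" for s
  proof -
    note s = converges_Mol[OF that]
    have "converges (\<lambda>n z. c * s n z) (\<lambda>z. c * m z)"
      using null_scale[OF Mol_diff[OF assms(1) s] converges_null[OF that], of c]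
      by (intro convergesI Mol_scale s) (simp add: algebra_simps)
    then show ?thesis
      using cls_converges cls_eq Mol_scale[OF assms] by blast
  qed
  moreover have "converges (\<lambda>n. m) m"
    using assms converges_const by auto
  ultimately show ?thesis
    unfolding free_scale_def cls_eq[OF assms(1)] by blast
qed

lemma free_diff_cls:
  "m \<in> Mol \<Longrightarrow> m' \<in> Mol \<Longrightarrow> free_diff p \<sigma> M b (cls m) (cls m') = cls (\<lambda>z. m z - m' z)"
  using free_add_cls[OF _ Mol_scale[of m' "- 1"], of m] by (simp add: free_diff_def free_scale_cls)

text \<open>The \<open>p\<close>-th power of the norm is continuous by the reverse triangle
  inequality, so all representatives yield the limit \<open>N m\<close>. The constant representative
  makes the limit unique, as the definite description requires.\<close>

lemma free_norm_cls:
  assumes m: "m \<in> Mol" shows "free_norm p \<sigma> M b (cls m) = N m"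
proof -
  have lim: "(\<lambda>n. N (s n)) \<longlonglongrightarrow> N m" if "converges s m" for s
  proof -
    note s = converges_Mol[OF that]
    have "(\<lambda>n. N (\<lambda>z. m z - s n z) powr p) \<longlonglongrightarrow> 0"
      by (rule iffD1[OF pnorm_null_powr_iff[OF Mol_diff[OF m s]] converges_null[OF that]])
    moreover have "\<bar>N (s n) powr p - N m powr p\<bar> \<le> N (\<lambda>z. m z - s n z) powr p" for n
      using pnorm_powr_add[OF s Mol_diff[OF m s], of n n] pnorm_powr_add[OF m Mol_diff[OF s m], of n]
        pnorm_minus_commute[OF m s, of n] by (simp add: abs_le_iff)
    ultimately have "(\<lambda>n. N (s n) powr p - N m powr p) \<longlonglongrightarrow> 0"
      by (intro Lim_null_comparison[OF always_eventually, of "\<lambda>n. N (s n) powr p - N m powr p"]) auto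
    then have "(\<lambda>n. N (s n) powr p) \<longlonglongrightarrow> N m powr p"
      by (rule LIM_zero_cancel)
    then have "(\<lambda>n. (N (s n) powr p) powr (1/p)) \<longlonglongrightarrow> (N m powr p) powr (1/p)"
      by (rule tendsto_powr'[OF _ tendsto_const]) (simp add: p_pos)
    then show ?thesis
      by (simp only: powr_inverse_p(2)[OF pnorm_ge_0] m s)
  qed
  have "l = N m" if "\<forall>s\<in>cls m. (\<lambda>n. N (s n)) \<longlonglongrightarrow> l" for l
    using that converges_const[OF m] by (auto simp: cls_eq[OF m] LIMSEQ_const_iff)
  then show ?thesis
    unfolding free_norm_def using lim by (intro the_equality) (auto simp: cls_eq[OF m])
qed

lemma cls_in_free_p_space: "m \<in> Mol \<Longrightarrow> cls m \<in> free_p_space p \<sigma> M b"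
  unfolding free_p_space_def cls_def
  by (intro quotientI converges_Cauchy[OF _ converges_const])

end

section \<open>Coefficients controlled by the norm\<close>

context p_molecules begin

text \<open>Adding the coefficient of \<open>b\<close> makes every molecule have total mass zero; in the resulting
  \<open>\<ell>\<^sub>p\<close> quasi-norm an atom of mass \<open>1/\<sigma>\<close> has \<open>p\<close>-th power at most \<open>2/\<delta>\<^sup>p\<close>.\<close>
lemma coefficient_bound:
  assumes m: "m \<in> Mol" and F: "finite F" "{z. m z \<noteq> 0} \<subseteq> F" "b \<notin> F"
    and \<delta>: "\<delta> > 0" "\<And>x y. x \<in> M \<Longrightarrow> y \<in> M \<Longrightarrow> x \<noteq> y \<Longrightarrow> \<delta> \<le> \<sigma> x y"
  shows "(\<Sum>z\<in>F. \<bar>m z\<bar> powr p) + \<bar>\<Sum>z\<in>F. m z\<bar> powr p \<le> 2 / \<delta> powr p * N m powr p"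
proof -
  have bound: "(\<Sum>z\<in>F. \<bar>m z\<bar> powr p) + \<bar>\<Sum>z\<in>F. m z\<bar> powr p \<le> 2 / \<delta> powr p * (\<Sum>i<n. \<bar>a i\<bar> powr p)"
    if r: "rep m n a x y" for n a x y
  proof -
    \<comment> \<open>\<open>G\<close> contains every point of the representation.
      \<open>f i\<close> is the difference of two full indicators, keeping the mass at
      \<open>b\<close> that \<open>delta b\<close> erases; hence \<open>g\<close> agrees with
      \<open>m\<close> off \<open>b\<close>.\<close>
    define G where "G = F \<union> x ` {..<n} \<union> y ` {..<n} \<union> {b}"
    define f where "f i z = (if z = x i then 1 else 0) - (if z = y i then 1 else (0::real))" for i z
    define g where "g z = (\<Sum>i<n. a i / \<sigma> (x i) (y i) * f i z)" for z
    have G: "finite G" "b \<in> G" "F \<subseteq> G - {b}" using F by (auto simp: G_def)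
    have xy: "x i \<in> M" "y i \<in> M" "x i \<noteq> y i" "x i \<in> G" "y i \<in> G" if "i < n" for i
      using r that by (auto simp: rep_def G_def)
    have mz: "m z = g z" if "z \<noteq> b" for z
    proof -
      have "m z = (\<Sum>i<n. a i * ((delta b (x i) z - delta b (y i) z) / \<sigma> (x i) (y i)))"
        using r unfolding rep_def by (metis (no_types, lifting))
      also have "\<dots> = g z"
        unfolding g_def f_def using that by (intro sum.cong) (auto simp: delta_def)
      finally show ?thesis .
    qed
    have "(\<Sum>z\<in>G. f i z) = 0" if "i < n" for i
      using xy[OF that] G(1) by (simp add: f_def sum_subtractf)
    then have "(\<Sum>i<n. a i / \<sigma> (x i) (y i) * (\<Sum>z\<in>G. f i z)) = 0"
      by (intro sum.neutral) auto
    then have "(\<Sum>z\<in>G. g z) = 0"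
      unfolding g_def by (subst sum.swap) (simp add: sum_distrib_left)
    \<comment> \<open>Total mass zero forces the coefficient at \<open>b\<close> to be minus the
      mass of \<open>m\<close>, which is the extra term of the estimate.\<close>
    then have "g b = - (\<Sum>z\<in>G - {b}. g z)"
      using sum.remove[OF G(1,2), of g] by simp
    also have "(\<Sum>z\<in>G - {b}. g z) = (\<Sum>z\<in>G - {b}. m z)"
      by (intro sum.cong) (auto simp: mz)
    also have "\<dots> = (\<Sum>z\<in>F. m z)"
      using G F(2) by (intro sum.mono_neutral_right) auto
    finally have gb: "\<bar>g b\<bar> = \<bar>\<Sum>z\<in>F. m z\<bar>" by simp
    have "(\<Sum>z\<in>F. \<bar>m z\<bar> powr p) = (\<Sum>z\<in>F. \<bar>g z\<bar> powr p)"
      using F(3) by (intro sum.cong refl) (metis mz)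
    also have "\<dots> \<le> (\<Sum>z\<in>G - {b}. \<bar>g z\<bar> powr p)"
      using G by (intro sum_mono2) auto
    finally have "(\<Sum>z\<in>F. \<bar>m z\<bar> powr p) + \<bar>\<Sum>z\<in>F. m z\<bar> powr p \<le> (\<Sum>z\<in>G. \<bar>g z\<bar> powr p)"
      using sum.remove[OF G(1,2), of "\<lambda>z. \<bar>g z\<bar> powr p"] gb by simp
    also have "\<dots> \<le> (\<Sum>z\<in>G. \<Sum>i<n. \<bar>a i / \<sigma> (x i) (y i) * f i z\<bar> powr p)"
      unfolding g_def by (intro sum_mono abs_sum_powr_le p_pos p_le_1)
    also have "\<dots> = (\<Sum>i<n. \<bar>a i / \<sigma> (x i) (y i)\<bar> powr p * (\<Sum>z\<in>G. \<bar>f i z\<bar> powr p))"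
      unfolding abs_mult powr_mult sum_distrib_left by (rule sum.swap)
    also have "\<dots> \<le> (\<Sum>i<n. (\<bar>a i\<bar> powr p / \<delta> powr p) * 2)"
    proof (intro sum_mono mult_mono)
      fix i assume "i \<in> {..<n}"
      then have i: "i < n" by simp
      have \<sigma>: "\<delta> \<le> \<sigma> (x i) (y i)" using \<delta>(2) xy[OF i] by blast
      have "\<bar>a i / \<sigma> (x i) (y i)\<bar> = \<bar>a i\<bar> / \<sigma> (x i) (y i)"
        using \<sigma> \<delta>(1) by simp
      also have "\<dots> \<le> \<bar>a i\<bar> / \<delta>"
        using \<sigma> \<delta>(1) by (intro divide_left_mono) auto
      finally have "\<bar>a i / \<sigma> (x i) (y i)\<bar> powr p \<le> (\<bar>a i\<bar> / \<delta>) powr p"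
        using p_pos by (intro powr_mono2) auto
      then show "\<bar>a i / \<sigma> (x i) (y i)\<bar> powr p \<le> \<bar>a i\<bar> powr p / \<delta> powr p"
        using \<delta>(1) by (simp add: powr_divide)
      \<comment> \<open>Each \<open>f i\<close> has two atoms of absolute value 1; this is the 2 in
        the bound.\<close>
      have "(\<Sum>z\<in>G. \<bar>f i z\<bar> powr p) \<le> (\<Sum>z\<in>G. (if z = x i then 1 else 0) + (if z = y i then 1 else 0))"
        by (intro sum_mono) (auto simp: f_def)
      then show "(\<Sum>z\<in>G. \<bar>f i z\<bar> powr p) \<le> 2"
        using xy[OF i] G(1) by (simp add: sum.distrib)
    qed (auto intro: sum_nonneg)
    also have "\<dots> = 2 / \<delta> powr p * (\<Sum>i<n. \<bar>a i\<bar> powr p)"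
      by (simp add: sum_distrib_left algebra_simps)
    finally show ?thesis .
  qed
  let ?L = "(\<Sum>z\<in>F. \<bar>m z\<bar> powr p) + \<bar>\<Sum>z\<in>F. m z\<bar> powr p"
  have "?L * \<delta> powr p / 2 \<le> N m powr p"
  proof (rule field_le_epsilon)
    fix e :: real assume "e > 0"
    obtain n a x y where r: "rep m n a x y" "(\<Sum>i<n. \<bar>a i\<bar> powr p) < N m powr p + e"
      using pnorm_powr_approx[OF m \<open>e > 0\<close>] .
    have "?L * \<delta> powr p / 2 \<le> (\<Sum>i<n. \<bar>a i\<bar> powr p)"
      using bound[OF r(1)] \<delta>(1) by (simp add: field_simps)
    then show "?L * \<delta> powr p / 2 \<le> N m powr p + e" using r(2) by simp
  qed
  then show ?thesis using \<delta>(1) by (simp add: field_simps)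
qed

end


section \<open>Multilinear interpolation on a cubical grid\<close>

definition in_cube :: "real \<Rightarrow> int ^ 'n \<Rightarrow> real ^ 'n \<Rightarrow> bool" where
  "in_cube R w x \<longleftrightarrow> (\<forall>i. R * of_int (w $ i) \<le> x $ i \<and> x $ i \<le> R * of_int (w $ i) + R)"

definition at_corner :: "real \<Rightarrow> int ^ 'n \<Rightarrow> real ^ 'n \<Rightarrow> 'n \<Rightarrow> bool" where
  "at_corner R w x i \<longleftrightarrow> x $ i = R * of_int (w $ i) \<or> x $ i = R * of_int (w $ i) + R"

definition vec_upd :: "'a ^ 'n \<Rightarrow> 'n \<Rightarrow> 'a \<Rightarrow> 'a ^ 'n" where
  "vec_upd x i a = (\<chi> j. if j = i then a else x $ j)"

text \<open>The nodal basis function of piecewise linear interpolation on the line with mesh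
  \<open>R\<close>.\<close>

definition hat :: "real \<Rightarrow> real \<Rightarrow> real" where
  "hat R s = max 0 (1 - \<bar>s\<bar> / R)"

text \<open>Indexing vertices by the set of coordinates at their upper end turns sums over the
  vertices of a cube into sums over the finite type \<open>'n set\<close>.\<close>

definition corner :: "real \<Rightarrow> int ^ 'n \<Rightarrow> 'n set \<Rightarrow> real ^ 'n" where
  "corner R w A = (\<chi> i. R * of_int (w $ i) + (if i \<in> A then R else 0))"

lemma vec_upd_nth [simp]: "vec_upd x i a $ j = (if j = i then a else x $ j)"
  by (simp add: vec_upd_def)

lemma grid_cube_iff:
  assumes "R > 0" shows "x \<in> grid_cube R w \<longleftrightarrow> in_cube R w x"
proof
  assume "x \<in> grid_cube R w"
  then obtain t where t: "x = (\<chi> i. R * of_int (w $ i) + R * t $ i)" "\<forall>i. t $ i \<in> {0..1}"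
    by (auto simp: grid_cube_def)
  have "R * t $ i \<le> R * 1" for i
    using t(2) assms by (intro mult_left_mono) auto
  then show "in_cube R w x"
    using t assms by (auto simp: in_cube_def)
next
  assume x: "in_cube R w x"
  define t :: "real ^ 'a" where "t = (\<chi> i. (x $ i - R * of_int (w $ i)) / R)"
  have "x = (\<chi> i. R * of_int (w $ i) + R * t $ i)"
    using assms by (simp add: t_def vec_eq_iff)
  moreover have "t $ i \<in> {0..1}" for i
    using x[unfolded in_cube_def, rule_format, of i] assms by (simp add: t_def field_simps)
  ultimately show "x \<in> grid_cube R w"
    unfolding grid_cube_def by blast
qed

lemma grid_cube_vertices_iff:
  assumes "R > 0" shows "x \<in> grid_cube_vertices R w \<longleftrightarrow> (\<forall>i. at_corner R w x i)"
proof
  assume "x \<in> grid_cube_vertices R w"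
  then show "\<forall>i. at_corner R w x i"
    by (auto simp: grid_cube_vertices_def at_corner_def)
next
  assume x: "\<forall>i. at_corner R w x i"
  define t :: "real ^ 'a" where "t = (\<chi> i. (x $ i - R * of_int (w $ i)) / R)"
  have "x = (\<chi> i. R * of_int (w $ i) + R * t $ i)"
    using assms by (simp add: t_def vec_eq_iff)
  moreover have "t $ i \<in> {0, 1}" for i
    using x[unfolded at_corner_def, rule_format, of i] assms by (auto simp: t_def field_simps)
  ultimately show "x \<in> grid_cube_vertices R w"
    unfolding grid_cube_vertices_def by blast
qed

lemma grid_cube_vertices_eq: 
  assumes "R > 0" shows "grid_cube_vertices R w = range (corner R w)"
proof -
  have "x = corner R w {i. x $ i = R * of_int (w $ i) + R}" if "\<forall>i. at_corner R w x i" for x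
    using that by (auto simp: corner_def at_corner_def vec_eq_iff)
  moreover have "at_corner R w (corner R w A) i" for A i
    by (auto simp: corner_def at_corner_def)
  ultimately show ?thesis
    using assms by (fastforce simp: grid_cube_vertices_iff)
qed

lemma inj_corner: "R > 0 \<Longrightarrow> inj (corner R w)"
  by (rule injI) (force simp: corner_def vec_eq_iff split: if_splits)

lemma in_cube_if_corners: "R > 0 \<Longrightarrow> \<forall>i. at_corner R w x i \<Longrightarrow> in_cube R w x"
  unfolding at_corner_def in_cube_def by (metis add.commute add_increasing less_imp_le order_refl)

text \<open>A node other than the two ends of a cell is at distance at least \<open>R\<close> from
  every point of the cell, so its hat vanishes there.\<close>

lemma hat_cell:
  assumes "R > 0" "R * of_int w \<le> s" "s \<le> R * of_int w + R"
  shows "hat R (s - R * of_int k) =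
    (if k = w then 1 - (s - R * of_int w) / R else if k = w + 1 then (s - R * of_int w) / R else 0)"
proof -
  consider "k = w" | "k = w + 1" | "k \<le> w - 1" | "k \<ge> w + 2" by linarith
  then show ?thesis
  proof cases
    case 3
    then have "R * of_int k \<le> R * (of_int w - 1)"
      using assms(1) by (intro mult_left_mono) linarith+
    then show ?thesis using 3 assms by (simp add: hat_def algebra_simps)
  next
    case 4
    then have "R * of_int k \<ge> R * (of_int w + 2)"
      using assms(1) by (intro mult_left_mono) linarith+
    then have "\<bar>s - R * of_int k\<bar> \<ge> R" using assms by (simp add: algebra_simps)
    then show ?thesis using 4 assms by (simp add: hat_def)
  qed (use assms in \<open>auto simp: hat_def max_def abs_if field_simps\<close>)
qed

text \<open>The kinks of a hat centred at a lattice point are themselves lattice points, hence never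
  interior to a cell.\<close>

lemma hat_affine:
  assumes "R > 0" "R * of_int w \<le> s" "s \<le> R * of_int w + R" "R * of_int w \<le> s'" "s' \<le> R * of_int w + R"
    and "0 \<le> t" "t \<le> 1"
  shows "hat R ((1 - t) * s + t * s' - R * of_int k)
    = (1 - t) * hat R (s - R * of_int k) + t * hat R (s' - R * of_int k)"
proof -
  have "(1 - t) * s + t * s' \<ge> (1 - t) * (R * of_int w) + t * (R * of_int w)"
    using assms by (intro add_mono mult_left_mono) auto
  moreover have "(1 - t) * s + t * s' \<le> (1 - t) * (R * of_int w + R) + t * (R * of_int w + R)"
    using assms by (intro add_mono mult_left_mono) auto
  ultimately have "R * of_int w \<le> (1 - t) * s + t * s'" "(1 - t) * s + t * s' \<le> R * of_int w + R"
    by (simp_all add: algebra_simps)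
  note hat_s = hat_cell[OF assms(1) this, of k]
  show ?thesis
    unfolding hat_s hat_cell[OF assms(1-3)] hat_cell[OF assms(1,4,5)]
    using assms(1) by (simp add: field_simps)
qed

lemma l1_dist_pos: "x \<noteq> y \<Longrightarrow> 0 < l1_dist x y"
  by (auto simp: l1_dist_def vec_eq_iff intro!: sum_pos2)

lemma l1_dist_nonneg: "0 \<le> l1_dist x y"
  by (simp add: l1_dist_def sum_nonneg)

lemma l1_dist_self [simp]: "l1_dist x x = 0"
  by (simp add: l1_dist_def)

lemma abs_nth_diff_le_l1_dist: "\<bar>x $ i - y $ i\<bar> \<le> l1_dist x y"
  unfolding l1_dist_def by (rule member_le_sum) auto

section \<open>Interpolating molecules on a union of grid cubes\<close>

locale cube_grid =
  fixes R p :: real and \<R> :: "(real ^ 'n) set set" and K V :: "(real ^ 'n) set" and b :: "real ^ 'n"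
  assumes R_pos: "R > 0" and p_gt_0: "0 < p" and p_le_one: "p \<le> 1"
    and \<R>_ne: "\<R> \<noteq> {}" and \<R>_sub: "\<R> \<subseteq> range (grid_cube R)"
    and K_eq: "K = \<Union>\<R>" and V_eq: "V = vertices_of R \<R>" and b_in: "b \<in> V"
begin

sublocale p_molecules p l1_dist V b
  using p_gt_0 p_le_one b_in l1_dist_pos by unfold_locales auto

definition W :: "(int ^ 'n) set" where "W = {w. grid_cube R w \<in> \<R>}"

text \<open>The value 0 at \<open>b\<close> reflects that the Dirac mass of the base point is the
  zero vector.\<close>

definition interp :: "real ^ 'n \<Rightarrow> real ^ 'n \<Rightarrow> real" where
  "interp x = (\<lambda>z. if z \<in> V \<and> z \<noteq> b then \<Prod>i\<in>UNIV. hat R (x $ i - z $ i) else 0)"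

lemma K_iff: "x \<in> K \<longleftrightarrow> (\<exists>w\<in>W. in_cube R w x)"
  using \<R>_sub R_pos unfolding K_eq W_def by (auto simp flip: grid_cube_iff)

lemma V_iff: "x \<in> V \<longleftrightarrow> (\<exists>w\<in>W. \<forall>i. at_corner R w x i)"
  by (simp add: V_eq vertices_of_def W_def grid_cube_vertices_iff R_pos)

lemma W_ne: "W \<noteq> {}"
  using \<R>_ne \<R>_sub unfolding W_def by auto

lemma V_lattice:
  assumes "z \<in> V" obtains k where "\<And>i. z $ i = R * of_int (k $ i)"
proof -
  obtain w where w: "at_corner R w z i" for i
    using assms by (auto simp: V_iff)
  have "z $ i = R * of_int ((\<chi> i. if z $ i = R * of_int (w $ i) then w $ i else w $ i + 1) $ i)" for i
    using w[of i] by (auto simp: at_corner_def algebra_simps)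
  then show ?thesis by (rule that)
qed

text \<open>A nonzero product needs a nonzero hat in every coordinate, and by
  \<open>hat_cell\<close> this leaves only the two ends of the cell in each of them.\<close>

lemma interp_support:
  assumes "in_cube R w x" "interp x z \<noteq> 0" shows "z \<in> V" "z \<noteq> b" "\<forall>i. at_corner R w z i"
proof -
  show z: "z \<in> V" "z \<noteq> b"
    using assms(2) by (auto simp: interp_def split: if_splits)
  then have nz: "hat R (x $ i - z $ i) \<noteq> 0" for i
    using assms(2) by (simp add: interp_def)
  obtain k where k: "z $ i = R * of_int (k $ i)" for i
    using z V_lattice by blast
  show "\<forall>i. at_corner R w z i"
  proof
    fix i
    have "k $ i = w $ i \<or> k $ i = w $ i + 1"
      using nz[of i] hat_cell[OF R_pos, of "w $ i" "x $ i" "k $ i"] assms(1)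
      unfolding k in_cube_def by metis
    then show "at_corner R w z i"
      using k[of i] by (auto simp: at_corner_def algebra_simps)
  qed
qed

lemma interp_Mol:
  assumes "in_cube R w x" shows "interp x \<in> Mol"
proof -
  have "{z. interp x z \<noteq> 0} \<subseteq> range (corner R w)"
    using interp_support(3)[OF assms] grid_cube_vertices_iff[OF R_pos, of _ w]
      grid_cube_vertices_eq[OF R_pos, of w] by blast
  then have "finite {z. interp x z \<noteq> 0}"
    by (rule finite_subset) simp
  moreover have "{z. interp x z \<noteq> 0} \<subseteq> V - {b}"
    using interp_support(1,2)[OF assms] by blast
  ultimately show ?thesis
    unfolding molecules_def by blast
qed

text \<open>At lattice points the hats reduce to Kronecker symbols.\<close>

lemma interp_vertex:
  assumes "x \<in> V" shows "interp x = delta b x"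
proof
  fix z
  show "interp x z = delta b x z"
  proof (cases "z \<in> V \<and> z \<noteq> b")
    case True
    obtain k where k: "x $ i = R * of_int (k $ i)" for i
      using assms V_lattice by blast
    obtain l where l: "z $ i = R * of_int (l $ i)" for i
      using True V_lattice by blast
    have h: "hat R (x $ i - z $ i) = (if x $ i = z $ i then 1 else 0)" for i
      using hat_cell[OF R_pos, of "k $ i" "x $ i" "l $ i"] R_pos k[of i] l[of i] by auto
    have h0: "hat R 0 = 1"
      by (simp add: hat_def)
    show ?thesis
    proof (cases "z = x")
      case True
      then show ?thesis using \<open>z \<in> V \<and> z \<noteq> b\<close> by (simp add: interp_def delta_def h0)
    next
      case False
      then obtain i where "x $ i \<noteq> z $ i" unfolding vec_eq_iff by metis
      then have "(\<Prod>i\<in>UNIV. hat R (x $ i - z $ i)) = 0"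
        using h by (intro prod_zero) auto
      then show ?thesis using False by (simp add: interp_def delta_def)
    qed
  next
    case False
    then show ?thesis using assms by (auto simp: interp_def delta_def)
  qed
qed

text \<open>Only the factor belonging to coordinate \<open>i\<close> changes, and it is affine on
  the cell by \<open>hat_affine\<close>; \<open>P\<close> is the product of the remaining
  factors.\<close>

lemma interp_affine:
  assumes "in_cube R w x" "in_cube R w y" "\<And>j. j \<noteq> i \<Longrightarrow> x $ j = y $ j" "0 \<le> t" "t \<le> 1"
  shows "interp ((1 - t) *\<^sub>R x + t *\<^sub>R y) = (\<lambda>z. (1 - t) * interp x z + t * interp y z)"
proof
  fix z
  show "interp ((1 - t) *\<^sub>R x + t *\<^sub>R y) z = (1 - t) * interp x z + t * interp y z"
  proof (cases "z \<in> V \<and> z \<noteq> b")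
    case True
    obtain k where k: "z $ i = R * of_int (k $ i)" for i
      using True V_lattice by blast
    define P where "P = (\<Prod>j\<in>UNIV - {i}. hat R (y $ j - z $ j))"
    have split: "interp u z = hat R (u $ i - z $ i) * P" if "\<And>j. j \<noteq> i \<Longrightarrow> u $ j = y $ j" for u
    proof -
      have "interp u z = hat R (u $ i - z $ i) * (\<Prod>j\<in>UNIV - {i}. hat R (u $ j - z $ j))"
        using True by (simp add: interp_def prod.remove[of UNIV i])
      also have "(\<Prod>j\<in>UNIV - {i}. hat R (u $ j - z $ j)) = P"
        unfolding P_def using that by (intro prod.cong) auto
      finally show ?thesis .
    qed
    have "((1 - t) *\<^sub>R x + t *\<^sub>R y) $ j = y $ j" if "j \<noteq> i" for j
      using assms(3)[OF that] by (simp add: algebra_simps)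
    then have "interp ((1 - t) *\<^sub>R x + t *\<^sub>R y) z = hat R ((1 - t) * x $ i + t * y $ i - z $ i) * P"
      by (subst split) simp_all
    also have "hat R ((1 - t) * x $ i + t * y $ i - z $ i)
        = (1 - t) * hat R (x $ i - z $ i) + t * hat R (y $ i - z $ i)"
      unfolding k using assms by (intro hat_affine[OF R_pos]) (auto simp: in_cube_def)
    finally show ?thesis
      using split[of x] split[of y] assms(3) by (simp add: algebra_simps)
  next
    case False
    then have "interp u z = 0" for u by (auto simp: interp_def)
    then show ?thesis by simp
  qed
qed

text \<open>Writes \<open>x\<close> as a convex combination of its projections to the two facets
  orthogonal to direction \<open>i\<close>. Repeated over several coordinates, this leads from an
  arbitrary point to vertices.\<close>

lemma interp_split:
  assumes "in_cube R w x" "t = (x $ i - R * of_int (w $ i)) / R"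
  shows "interp x = (\<lambda>z. (1 - t) * interp (vec_upd x i (R * of_int (w $ i))) z
      + t * interp (vec_upd x i (R * of_int (w $ i) + R)) z)"
    and "0 \<le> t" "t \<le> 1"
    and "in_cube R w (vec_upd x i (R * of_int (w $ i)))" "in_cube R w (vec_upd x i (R * of_int (w $ i) + R))"
    and "x = (1 - t) *\<^sub>R vec_upd x i (R * of_int (w $ i)) + t *\<^sub>R vec_upd x i (R * of_int (w $ i) + R)"
proof -
  show t: "0 \<le> t" "t \<le> 1"
    using assms(1)[unfolded in_cube_def, rule_format, of i] R_pos by (auto simp: assms(2) field_simps)
  show c: "in_cube R w (vec_upd x i (R * of_int (w $ i)))" "in_cube R w (vec_upd x i (R * of_int (w $ i) + R))"
    using assms(1) R_pos by (auto simp: in_cube_def)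
  show x: "x = (1 - t) *\<^sub>R vec_upd x i (R * of_int (w $ i)) + t *\<^sub>R vec_upd x i (R * of_int (w $ i) + R)"
    using R_pos by (auto simp: vec_eq_iff assms(2) field_simps)
  show "interp x = (\<lambda>z. (1 - t) * interp (vec_upd x i (R * of_int (w $ i))) z
      + t * interp (vec_upd x i (R * of_int (w $ i) + R)) z)"
    by (subst x, rule interp_affine[OF c, where i = i]) (simp_all add: t)
qed

section \<open>Existence and uniqueness of the interpolation\<close>

lemma free_delta_eq: "free_delta p l1_dist V b v = cls (delta b v)"
  by (simp add: free_delta_def cls_def)

text \<open>Induction on a set \<open>S\<close> outside of which all coordinates are at vertex
  positions: affinity in one coordinate of \<open>S\<close> reduces the value at \<open>x\<close> to
  values at two points with one free coordinate fewer, and vertices have prescribed values. Taking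
  \<open>S = UNIV\<close> covers the cube.\<close>

lemma interpolation_eq_on_cube:
  assumes r: "is_vertex_interpolation p V b K \<R> r" and w: "w \<in> W" and x: "in_cube R w x"
  shows "r x = cls (interp x)"
proof -
  have affine: "coordinatewise_affine_on (free_add p l1_dist V b) (free_scale p l1_dist V b) (grid_cube R w) r"
    and vertex: "\<And>v. v \<in> V \<Longrightarrow> r v = free_delta p l1_dist V b v"
    using r w by (auto simp: is_vertex_interpolation_def W_def)
  have "r x = cls (interp x)" if "in_cube R w x" "\<forall>i. i \<notin> S \<longrightarrow> at_corner R w x i" for S x
    using finite[of S] that
  proof (induction S arbitrary: x rule: finite_induct)
    case empty
    then have "x \<in> V" using w by (auto simp: V_iff)
    then show ?case by (simp add: vertex free_delta_eq interp_vertex)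
  next
    case (insert i S)
    define t where "t = (x $ i - R * of_int (w $ i)) / R"
    define lo where "lo = vec_upd x i (R * of_int (w $ i))"
    define hi where "hi = vec_upd x i (R * of_int (w $ i) + R)"
    note s = interp_split[OF insert.prems(1) t_def, folded lo_def hi_def]
    have "r lo = cls (interp lo)" "r hi = cls (interp hi)"
      using insert.prems(2)
      by (auto intro!: insert.IH s(4,5)[unfolded lo_def hi_def] simp: lo_def hi_def at_corner_def)
    moreover have "r x = free_add p l1_dist V b (free_scale p l1_dist V b (1 - t) (r lo))
        (free_scale p l1_dist V b t (r hi))"
      unfolding s(6)
      using s(2-5) by (intro affine[unfolded coordinatewise_affine_on_def, rule_format, of _ _ i])
        (auto simp: grid_cube_iff R_pos lo_def hi_def)
    ultimately show ?case
      using s(4,5) interp_Mol by (simp add: free_add_cls free_scale_cls Mol_scale s(1))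
  qed
  from this[of x UNIV] x show ?thesis by simp
qed

lemma interpolation_exists:
  "is_vertex_interpolation p V b K \<R> (\<lambda>x\<in>K. cls (interp x))"
proof -
  have VK: "V \<subseteq> K"
    using in_cube_if_corners[OF R_pos] V_iff K_iff by blast
  have "coordinatewise_affine_on (free_add p l1_dist V b) (free_scale p l1_dist V b) Q (\<lambda>x\<in>K. cls (interp x))"
    if "Q \<in> \<R>" for Q
    unfolding coordinatewise_affine_on_def
  proof (intro allI ballI impI)
    fix i x y and t :: real
    assume xy: "x \<in> Q" "y \<in> Q" "\<forall>j. j \<noteq> i \<longrightarrow> x $ j = y $ j" and t: "t \<in> {0..1}"
    obtain w where w: "w \<in> W" "Q = grid_cube R w"
    proof -
      obtain w where "Q = grid_cube R w" using \<open>Q \<in> \<R>\<close> \<R>_sub by blast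
      then show ?thesis using \<open>Q \<in> \<R>\<close> by (intro that[of w]) (auto simp: W_def)
    qed
    then have c: "in_cube R w x" "in_cube R w y"
      using xy by (simp_all add: grid_cube_iff R_pos)
    have "in_cube R w ((1 - t) *\<^sub>R x + t *\<^sub>R y)"
      unfolding in_cube_def
    proof (intro allI conjI)
      fix j
      have "(1 - t) * (R * of_int (w $ j)) + t * (R * of_int (w $ j)) \<le> (1 - t) * x $ j + t * y $ j"
        using c t by (intro add_mono mult_left_mono) (auto simp: in_cube_def)
      then show "R * of_int (w $ j) \<le> ((1 - t) *\<^sub>R x + t *\<^sub>R y) $ j" by (simp add: algebra_simps)
      have "(1 - t) * x $ j + t * y $ j \<le> (1 - t) * (R * of_int (w $ j) + R) + t * (R * of_int (w $ j) + R)"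
        using c t by (intro add_mono mult_left_mono) (auto simp: in_cube_def)
      then show "((1 - t) *\<^sub>R x + t *\<^sub>R y) $ j \<le> R * of_int (w $ j) + R" by (simp add: algebra_simps)
    qed
    then show "(\<lambda>x\<in>K. cls (interp x)) ((1 - t) *\<^sub>R x + t *\<^sub>R y) =
      free_add p l1_dist V b (free_scale p l1_dist V b (1 - t) ((\<lambda>x\<in>K. cls (interp x)) x))
        (free_scale p l1_dist V b t ((\<lambda>x\<in>K. cls (interp x)) y))"
      using c w(1) xy(3) t interp_Mol[OF c(1)] interp_Mol[OF c(2)] K_iff interp_affine[OF c, of i t]
      by (simp add: restrict_def free_add_cls free_scale_cls Mol_scale bexI[of _ w])
  qed
  then show ?thesis
    using VK interp_Mol by (auto simp: is_vertex_interpolation_def free_delta_eq interp_vertex K_iff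
        intro!: cls_in_free_p_space)
qed

lemma interpolation_eq:
  assumes "is_vertex_interpolation p V b K \<R> r" "x \<in> K" shows "r x = cls (interp x)"
  using interpolation_eq_on_cube[OF assms(1)] assms(2) by (auto simp: K_iff)

lemma ex1_interpolation: "\<exists>!r. is_vertex_interpolation p V b K \<R> r"
proof (intro ex1I[of _ "\<lambda>x\<in>K. cls (interp x)"] interpolation_exists)
  fix r assume r: "is_vertex_interpolation p V b K \<R> r"
  then have "r \<in> extensional K"
    by (auto simp: is_vertex_interpolation_def PiE_def)
  then show "r = (\<lambda>x\<in>K. cls (interp x))"
    using interpolation_eq[OF r] by (intro extensionalityI[of _ K]) auto
qed

text \<open>Reduces the Lipschitz constant to norms of molecules; the completion does not enter the
  estimates below.\<close>

lemma free_Lip_eq: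
  assumes r: "is_vertex_interpolation p V b K \<R> r"
  shows "free_Lip p l1_dist V b K r = (SUP (x, y) \<in> {(x, y). x \<in> K \<and> y \<in> K \<and> x \<noteq> y}.
    ereal (N (\<lambda>z. interp x z - interp y z) / l1_dist x y))"
proof -
  have "ereal (free_norm p l1_dist V b (free_diff p l1_dist V b (r x) (r y)) / l1_dist x y)
      = ereal (N (\<lambda>z. interp x z - interp y z) / l1_dist x y)" if "x \<in> K" "y \<in> K" for x y
  proof -
    have "interp x \<in> Mol" "interp y \<in> Mol" using interp_Mol that by (auto simp: K_iff)
    then show ?thesis
      using interpolation_eq[OF r] that by (simp add: free_diff_cls free_norm_cls Mol_diff)
  qed
  then show ?thesis
    unfolding free_Lip_def by (intro SUP_cong) auto
qed

end


section \<open>The Lipschitz constant\<close>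

lemma C_const_powr:
  assumes "0 < p" shows "C_const p n powr p = real n powr (1 - p)"
  using assms by (simp add: C_const_def powr_powr algebra_simps)

lemma C_const_nonneg: "0 \<le> C_const p n"
  by (simp add: C_const_def)

section \<open>Upper bound for the Lipschitz constant\<close>

context cube_grid begin

definition D :: "real ^ 'n \<Rightarrow> real ^ 'n \<Rightarrow> real" where
  "D x y = N (\<lambda>z. interp x z - interp y z) powr p"

text \<open>The maximum of \<open>(1 - t) powr p + t powr p\<close> over [0,1], attained at 1/2. Its
  power with exponent \<open>d - 1\<close> is the \<open>p\<close>-th power of
  \<open>C_const p (2 ^ (d - 1))\<close>.\<close>

definition B :: real where "B = 2 powr (1 - p)"

lemma B_ge_1: "1 \<le> B"
  using p_le_one by (simp add: B_def ge_one_powr_ge_zero)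

lemma D_triangle:
  assumes "interp x \<in> Mol" "interp y \<in> Mol" "interp z \<in> Mol"
  shows "D x z \<le> D x y + D y z"
  using pnorm_powr_add[OF Mol_diff[OF assms(1,2)] Mol_diff[OF assms(2,3)]] by (simp add: D_def)

lemma l1_dist_vec_upd: "x $ i = y $ i \<Longrightarrow> l1_dist (vec_upd x i a) (vec_upd y i a) = l1_dist x y"
  unfolding l1_dist_def by (intro sum.cong) auto

text \<open>In a coordinate of \<open>S\<close> both points split with the same weight, so their
  difference is a convex combination of two differences of the same kind. Moving both points to the
  same facet position keeps their distance. Each coordinate of \<open>S\<close> costs one factor
  \<open>B\<close>, and with \<open>S\<close> exhausted both points are vertices.\<close>

lemma parallel_bound:
  assumes "w \<in> W" "w' \<in> W" "\<And>i. i \<in> S \<Longrightarrow> w $ i = w' $ i"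
    and "in_cube R w x" "in_cube R w' y"
    and "\<And>i. i \<in> S \<Longrightarrow> x $ i = y $ i" "\<And>i. i \<notin> S \<Longrightarrow> at_corner R w x i \<and> at_corner R w' y i"
  shows "D x y \<le> B ^ card S * l1_dist x y powr p"
  using finite[of S] assms(3-7)
proof (induction S arbitrary: x y rule: finite_induct)
  case empty
  then have "x \<in> V" "y \<in> V" using assms(1,2) by (auto simp: V_iff)
  then show ?case
    using pnorm_delta_diff[of x y] by (auto simp: D_def interp_vertex split: if_splits)
next
  case (insert i S)
  define t where "t = (x $ i - R * of_int (w $ i)) / R"
  define lo hi where "lo = R * of_int (w $ i)" and "hi = R * of_int (w $ i) + R"
  \<comment> \<open>The cubes and the points agree in coordinate \<open>i\<close>, so weight and
    facet positions are common to \<open>x\<close> and \<open>y\<close>.\<close>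
  have ty: "t = (y $ i - R * of_int (w' $ i)) / R" "lo = R * of_int (w' $ i)" "hi = R * of_int (w' $ i) + R"
    and xy: "x $ i = y $ i"
    using insert.prems(1,4)[of i] by (simp_all add: t_def lo_def hi_def)
  note sx = interp_split[OF insert.prems(2) t_def, folded lo_def hi_def]
  note sy = interp_split[OF insert.prems(3) ty(1), folded ty(2,3)]
  have IH: "D (vec_upd x i a) (vec_upd y i a) \<le> B ^ card S * l1_dist x y powr p"
    if a: "a = lo \<or> a = hi" for a
    unfolding l1_dist_vec_upd[OF xy, of a, symmetric]
  proof (rule insert.IH)
    show "in_cube R w (vec_upd x i a)" "in_cube R w' (vec_upd y i a)"
      using a sx(4,5) sy(4,5) by auto
    show "at_corner R w (vec_upd x i a) j \<and> at_corner R w' (vec_upd y i a) j" if "j \<notin> S" for j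
      using insert.prems(5)[of j] that a ty(2,3) by (auto simp: at_corner_def lo_def hi_def)
  qed (use insert.prems insert.hyps in auto)
  define \<Delta> where "\<Delta> a = (\<lambda>z. interp (vec_upd x i a) z - interp (vec_upd y i a) z)" for a
  have \<Delta>: "\<Delta> lo \<in> Mol" "\<Delta> hi \<in> Mol"
    unfolding \<Delta>_def using Mol_diff interp_Mol sx(4,5) sy(4,5) by blast+
  have "D x y = N (\<lambda>z. (1 - t) * \<Delta> lo z + t * \<Delta> hi z) powr p"
    unfolding D_def sx(1) sy(1) \<Delta>_def by (simp add: algebra_simps)
  also have "\<dots> \<le> N (\<lambda>z. (1 - t) * \<Delta> lo z) powr p + N (\<lambda>z. t * \<Delta> hi z) powr p"
    by (intro pnorm_powr_add Mol_scale \<Delta>)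
  also have "\<dots> \<le> \<bar>1 - t\<bar> powr p * N (\<Delta> lo) powr p + \<bar>t\<bar> powr p * N (\<Delta> hi) powr p"
    by (intro add_mono pnorm_powr_scale_le \<Delta>)
  also have "\<dots> \<le> \<bar>1 - t\<bar> powr p * (B ^ card S * l1_dist x y powr p)
      + \<bar>t\<bar> powr p * (B ^ card S * l1_dist x y powr p)"
    using IH[of lo] IH[of hi] by (intro add_mono mult_left_mono) (auto simp: D_def \<Delta>_def)
  also have "\<dots> = ((1 - t) powr p + t powr p) * (B ^ card S * l1_dist x y powr p)"
    using sx(2,3) by (simp add: algebra_simps)
  also have "\<dots> \<le> B * (B ^ card S * l1_dist x y powr p)"
  proof (rule mult_right_mono)
    \<comment> \<open>The two-term case of \<open>sum_powr_le\<close>, with the weights indexed by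
      \<open>bool\<close> and adding up to 1.\<close>
    show "(1 - t) powr p + t powr p \<le> B"
      using sum_powr_le[of "UNIV :: bool set" "\<lambda>c. if c then t else 1 - t" p] sx(2,3) p_gt_0 p_le_one
      by (simp add: UNIV_bool B_def)
  qed (use B_ge_1 in auto)
  finally show ?case using insert.hyps by simp
qed

text \<open>Along a line in direction \<open>i\<close> the interpolation is affine, so the
  difference is \<open>t - u\<close> times that of the end points \<open>hi\<close> and
  \<open>lo\<close> on opposite facets. These agree in the other \<open>d - 1\<close> coordinates
  and are at distance \<open>R\<close>, so \<open>parallel_bound\<close> applies.\<close>

lemma one_coordinate_bound:
  assumes w: "w \<in> W" and x: "in_cube R w x" and y: "in_cube R w y"
    and xy: "\<And>j. j \<noteq> i \<Longrightarrow> x $ j = y $ j"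
  shows "D x y \<le> B ^ (CARD('n) - 1) * \<bar>x $ i - y $ i\<bar> powr p"
proof -
  define t u where "t = (x $ i - R * of_int (w $ i)) / R" and "u = (y $ i - R * of_int (w $ i)) / R"
  define lo where "lo = vec_upd x i (R * of_int (w $ i))"
  define hi where "hi = vec_upd x i (R * of_int (w $ i) + R)"
  have y_upd: "lo = vec_upd y i (R * of_int (w $ i))" "hi = vec_upd y i (R * of_int (w $ i) + R)"
    using xy by (simp_all add: lo_def hi_def vec_eq_iff)
  note sx = interp_split[OF x t_def, folded lo_def hi_def]
  note sy = interp_split[OF y u_def, folded y_upd]
  have "D hi lo \<le> B ^ card (UNIV - {i}) * l1_dist hi lo powr p"
  proof (rule parallel_bound[OF w w])
    show "hi $ j = lo $ j" if "j \<in> UNIV - {i}" for j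
      using that by (simp add: hi_def lo_def)
    show "at_corner R w hi j \<and> at_corner R w lo j" if "j \<notin> UNIV - {i}" for j
      using that by (simp add: hi_def lo_def at_corner_def)
  qed (use sx in auto)
  also have "l1_dist hi lo = (\<Sum>j\<in>UNIV. if j = i then R else 0)"
    unfolding l1_dist_def hi_def lo_def using R_pos by (intro sum.cong) auto
  finally have hl: "D hi lo \<le> B ^ (CARD('n) - 1) * R powr p"
    by (simp add: card_Diff_singleton)
  have "D x y = N (\<lambda>z. (t - u) * (interp hi z - interp lo z)) powr p"
    unfolding D_def sx(1) sy(1) by (simp add: algebra_simps)
  also have "\<dots> \<le> \<bar>t - u\<bar> powr p * D hi lo"
    unfolding D_def using sx(4,5) by (intro pnorm_powr_scale_le Mol_diff interp_Mol)
  also have "\<dots> \<le> \<bar>t - u\<bar> powr p * (B ^ (CARD('n) - 1) * R powr p)"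
    by (intro mult_left_mono hl) auto
  also have "\<dots> = B ^ (CARD('n) - 1) * (\<bar>t - u\<bar> * R) powr p"
    using R_pos by (simp add: powr_mult)
  also have "\<bar>t - u\<bar> * R = \<bar>x $ i - y $ i\<bar>"
    using R_pos by (simp add: t_def u_def abs_divide flip: diff_divide_distrib)
  finally show ?thesis .
qed

text \<open>The coordinates are changed one at a time from \<open>x\<close> to \<open>y\<close>,
  with \<open>h S\<close> the stage at which those in \<open>S\<close> have been changed. Passing
  from the sum of the powers to the power of the sum costs the factor with base
  \<open>d\<close>.\<close>

lemma cube_bound:
  assumes w: "w \<in> W" and x: "in_cube R w x" and y: "in_cube R w y"
  shows "D x y \<le> B ^ (CARD('n) - 1) * real CARD('n) powr (1 - p) * l1_dist x y powr p"
proof -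
  define h where "h S = (\<chi> i. if i \<in> S then y $ i else x $ i)" for S
  have h: "in_cube R w (h S)" for S
    using x y by (auto simp: in_cube_def h_def)
  have "D x (h S) \<le> B ^ (CARD('n) - 1) * (\<Sum>i\<in>S. \<bar>x $ i - y $ i\<bar> powr p)" for S
    using finite[of S]
  proof (induction S rule: finite_induct)
    case empty
    have "h {} = x" by (simp add: h_def vec_eq_iff)
    \<comment> \<open>The norm of the zero molecule is obtained from \<open>pnorm_delta_diff\<close>
      at \<open>b\<close>.\<close>
    then show ?case
      using pnorm_delta_diff[OF b_in b_in] by (simp add: D_def)
  next
    case (insert i S)
    have "D x (h (insert i S)) \<le> D x (h S) + D (h S) (h (insert i S))"
      by (intro D_triangle interp_Mol[OF x] interp_Mol[OF h])
    also have "D (h S) (h (insert i S)) \<le> B ^ (CARD('n) - 1) * \<bar>h S $ i - h (insert i S) $ i\<bar> powr p"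
      by (intro one_coordinate_bound[OF w h h]) (auto simp: h_def)
    also have "h S $ i - h (insert i S) $ i = x $ i - y $ i"
      using insert.hyps by (simp add: h_def)
    finally show ?case
      using insert by (simp add: algebra_simps)
  qed
  from this[of UNIV] have "D x y \<le> B ^ (CARD('n) - 1) * (\<Sum>i\<in>UNIV. \<bar>x $ i - y $ i\<bar> powr p)"
    by (simp add: h_def)
  also have "\<dots> \<le> B ^ (CARD('n) - 1) * (real CARD('n) powr (1 - p) * l1_dist x y powr p)"
    using sum_powr_le[of UNIV "\<lambda>i. \<bar>x $ i - y $ i\<bar>" p] p_gt_0 p_le_one B_ge_1
    by (intro mult_left_mono) (auto simp: l1_dist_def)
  finally show ?thesis by simp
qed

text \<open>Each of three legs costs at most the constant of \<open>cube_bound\<close>, and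
  \<open>sum_powr_le\<close> for three terms compares the powers of their lengths with that of the
  total. Inside one cube a single leg suffices.\<close>

lemma upper_bound_powr:
  assumes "x \<in> K" "y \<in> K"
  shows "D x y \<le> B ^ (CARD('n) - 1) * real CARD('n) powr (1 - p) * 3 powr (1 - p) * l1_dist x y powr p"
proof -
  obtain w w' where w: "w \<in> W" "in_cube R w x" and w': "w' \<in> W" "in_cube R w' y"
    using assms by (auto simp: K_iff)
  define c where "c = B ^ (CARD('n) - 1) * real CARD('n) powr (1 - p)"
  have n1: "1 \<le> real CARD('n) powr (1 - p)" and one3: "1 \<le> (3::real) powr (1 - p)"
    using p_le_one by (auto intro!: ge_one_powr_ge_zero simp: Suc_le_eq)
  have c0: "0 \<le> c" using B_ge_1 by (simp add: c_def)
  show ?thesis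
  proof (cases "w = w'")
    case True
    then have "D x y \<le> c * l1_dist x y powr p"
      unfolding c_def using cube_bound w w' by blast
    also have "\<dots> \<le> c * l1_dist x y powr p * 3 powr (1 - p)"
      using mult_left_mono[OF one3, of "c * l1_dist x y powr p"] c0 by simp
    finally show ?thesis by (simp add: c_def mult_ac)
  next
    case False
    text \<open>Walk inside the first cube to the face nearest to the second one, jump to the facing point of
      the second cube, and walk on inside it; this path is an \<open>\<ell>\<^sub>1\<close>-geodesic.\<close>
    define S where "S = {i. w $ i = w' $ i}"
    define x' :: "real ^ 'n" where "x' = (\<chi> i. if i \<in> S then x $ i
      else if w $ i < w' $ i then R * of_int (w $ i) + R else R * of_int (w $ i))"
    \<comment> \<open>On \<open>S\<close> the jump keeps the coordinates of \<open>x\<close>, which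
      are admissible in the second cube because the two indices agree there; the last leg adjusts
      them to \<open>y\<close>.\<close>
    define y' :: "real ^ 'n" where "y' = (\<chi> i. if i \<in> S then x $ i
      else if w $ i < w' $ i then R * of_int (w' $ i) else R * of_int (w' $ i) + R)"
    have "R * of_int (w $ i) \<le> x $ i \<and> x $ i \<le> R * of_int (w $ i) + R" for i
      using w(2) by (simp add: in_cube_def)
    then have x': "in_cube R w x'" and y': "in_cube R w' y'"
      unfolding in_cube_def x'_def y'_def S_def using R_pos by (auto split: if_splits) metis+
    have geodesic: "l1_dist x x' + l1_dist x' y' + l1_dist y' y = l1_dist x y"
      unfolding l1_dist_def sum.distrib[symmetric]
    proof (intro sum.cong refl)
      fix i
      \<comment> \<open>Cells with different indices are ordered along the axis, so the path is
        monotone in every coordinate outside \<open>S\<close>.\<close>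
      have le: "R * of_int k + R \<le> R * of_int l" if "k < l" for k l
        using mult_left_mono[of "of_int k + 1" "of_int l" R] that R_pos by (simp add: algebra_simps)
      have "R * of_int (w $ i) \<le> x $ i" "x $ i \<le> R * of_int (w $ i) + R"
        "R * of_int (w' $ i) \<le> y $ i" "y $ i \<le> R * of_int (w' $ i) + R"
        using w(2) w'(2) by (auto simp: in_cube_def)
      then show "\<bar>x $ i - x' $ i\<bar> + \<bar>x' $ i - y' $ i\<bar> + \<bar>y' $ i - y $ i\<bar> = \<bar>x $ i - y $ i\<bar>"
        using le[of "w $ i" "w' $ i"] le[of "w' $ i" "w $ i"]
        by (cases "w $ i" "w' $ i" rule: linorder_cases) (auto simp: x'_def y'_def S_def)
    qed
    \<comment> \<open>Distinct cubes differ in some index, so the jump needs at most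
      \<open>d - 1\<close> splittings and its constant does not exceed \<open>c\<close>.\<close>
    have "S \<noteq> UNIV" using False by (auto simp: S_def vec_eq_iff)
    then have "card S < CARD('n)" by (intro psubset_card_mono) auto
    have "D x' y' \<le> B ^ card S * l1_dist x' y' powr p"
      by (rule parallel_bound[OF w(1) w'(1) _ x' y']) (auto simp: S_def x'_def y'_def at_corner_def)
    also have "\<dots> \<le> c * l1_dist x' y' powr p"
    proof (rule mult_right_mono)
      have "B ^ card S * 1 \<le> B ^ (CARD('n) - 1) * real CARD('n) powr (1 - p)"
        using \<open>card S < CARD('n)\<close> B_ge_1 n1 by (intro mult_mono power_increasing) auto
      then show "B ^ card S \<le> c" by (simp add: c_def)
    qed simp
    finally have mid: "D x' y' \<le> c * l1_dist x' y' powr p" .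
    have "D x y \<le> D x x' + (D x' y' + D y' y)"
      using D_triangle[of x x' y] D_triangle[of x' y' y] w(2) w'(2) x' y' interp_Mol by force
    also have "\<dots> \<le> c * l1_dist x x' powr p + (c * l1_dist x' y' powr p + c * l1_dist y' y powr p)"
      using cube_bound[OF w x'] cube_bound[OF w'(1) y' w'(2)] mid unfolding c_def by (intro add_mono)
    also have "\<dots> = c * (l1_dist x x' powr p + (l1_dist x' y' powr p + l1_dist y' y powr p))"
      by (simp add: algebra_simps)
    also have "\<dots> \<le> c * (3 powr (1 - p) * l1_dist x y powr p)"
    proof (intro mult_left_mono c0)
      show "l1_dist x x' powr p + (l1_dist x' y' powr p + l1_dist y' y powr p)
        \<le> 3 powr (1 - p) * l1_dist x y powr p"
        \<comment> \<open>The three leg lengths are indexed by their positions in a list.\<close>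
        using sum_powr_le[of "{..<3::nat}" "(!) [l1_dist x x', l1_dist x' y', l1_dist y' y]" p]
          p_gt_0 p_le_one geodesic
        by (force simp: numeral_3_eq_3 less_Suc_eq l1_dist_nonneg algebra_simps)
    qed
    finally show ?thesis by (simp add: c_def mult_ac)
  qed
qed

lemma upper_bound:
  assumes "x \<in> K" "y \<in> K"
  shows "N (\<lambda>z. interp x z - interp y z)
    \<le> C_const p (2 ^ (CARD('n) - 1)) * C_const p CARD('n) * C_const p 3 * l1_dist x y"
    (is "_ \<le> ?c * _")
proof -
  have "(?c * l1_dist x y) powr p = B ^ (CARD('n) - 1) * real CARD('n) powr (1 - p) * 3 powr (1 - p) * l1_dist x y powr p"
    by (simp add: powr_mult C_const_nonneg l1_dist_nonneg C_const_powr p_gt_0 B_def powr_power powr_realpow[symmetric] powr_powr mult_ac)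
  then have "D x y \<le> (?c * l1_dist x y) powr p"
    using upper_bound_powr[OF assms] by simp
  then show ?thesis
    unfolding D_def by (rule powr_p_le_cancel[rotated]) (simp add: C_const_nonneg l1_dist_nonneg)
qed

section \<open>Lower bound for the Lipschitz constant\<close>

lemma l1_dist_V_ge:
  assumes "x \<in> V" "y \<in> V" "x \<noteq> y" shows "R \<le> l1_dist x y"
proof -
  obtain k where k: "x $ i = R * of_int (k $ i)" for i
    using assms(1) V_lattice by blast
  obtain l where l: "y $ i = R * of_int (l $ i)" for i
    using assms(2) V_lattice by blast
  obtain i where "x $ i \<noteq> y $ i" using assms(3) unfolding vec_eq_iff by metis
  then have "1 \<le> \<bar>k $ i - l $ i\<bar>" using k[of i] l[of i] by auto
  then have "R * 1 \<le> R * of_int \<bar>k $ i - l $ i\<bar>"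
    using R_pos by (intro mult_left_mono) auto
  also have "\<dots> = \<bar>x $ i - y $ i\<bar>"
    using R_pos by (simp add: k l abs_mult flip: right_diff_distrib)
  also have "\<dots> \<le> l1_dist x y" by (rule abs_nth_diff_le_l1_dist)
  finally show ?thesis by simp
qed

text \<open>With \<open>c\<close> the absolute value of the coefficients,
  \<open>coefficient_bound\<close> for separation \<open>R\<close> shows that the
  \<open>p\<close>-th power of the norm is at least
  \<open>2 ^ (d - 1) * c powr p * R powr p\<close>, while the two centres are at distance
  \<open>R\<close>.\<close>

lemma lower_bound:
  obtains x y where "x \<in> K" "y \<in> K" "x \<noteq> y"
    "C_const p (2 ^ (CARD('n) - 1)) * l1_dist x y \<le> N (\<lambda>z. interp x z - interp y z)"
proof -
  obtain w where w: "w \<in> W" using W_ne by blast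
  \<comment> \<open>Types are nonempty, so a coordinate direction can be chosen.\<close>
  obtain i0 :: 'n where True by blast
  text \<open>The centres of two opposite facets.\<close>
  define x :: "real ^ 'n" where "x = (\<chi> i. if i = i0 then R * of_int (w $ i) else R * of_int (w $ i) + R / 2)"
  define y :: "real ^ 'n" where "y = (\<chi> i. if i = i0 then R * of_int (w $ i) + R else R * of_int (w $ i) + R / 2)"
  \<comment> \<open>Each of the \<open>d - 1\<close> coordinates other than \<open>i0\<close> is
    midway between two nodes and contributes a hat value 1/2. The sign in \<open>g\<close> tells
    which facet contains the vertex.\<close>
  define c :: real where "c = (1 / 2) ^ (CARD('n) - 1)"
  define g where "g A = (if i0 \<in> A then - c else c)" for A
  define m where "m = (\<lambda>z. interp x z - interp y z)"
  have xc: "in_cube R w x" and yc: "in_cube R w y"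
    using R_pos by (auto simp: in_cube_def x_def y_def)
  have "l1_dist x y = (\<Sum>j\<in>UNIV. if j = i0 then R else 0)"
    unfolding l1_dist_def x_def y_def using R_pos by (intro sum.cong) auto
  then have dist: "l1_dist x y = R" by simp
  have corner_V: "corner R w A \<in> V" for A
    using w by (auto simp: V_iff corner_def at_corner_def)
  have m_corner: "m (corner R w A) = g A" if "corner R w A \<noteq> b" for A
  proof -
    have prod: "interp u (corner R w A) = hat R (u $ i0 - corner R w A $ i0) * c"
      if "\<And>i. i \<noteq> i0 \<Longrightarrow> u $ i = R * of_int (w $ i) + R / 2" for u
    proof -
      have "interp u (corner R w A) = hat R (u $ i0 - corner R w A $ i0)
          * (\<Prod>i\<in>UNIV - {i0}. hat R (u $ i - corner R w A $ i))"
        using corner_V \<open>corner R w A \<noteq> b\<close> by (simp add: interp_def prod.remove[of UNIV i0])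
      also have "(\<Prod>i\<in>UNIV - {i0}. hat R (u $ i - corner R w A $ i)) = (\<Prod>i\<in>UNIV - {i0}. 1 / 2)"
        using that R_pos by (intro prod.cong) (auto simp: corner_def hat_def)
      finally show ?thesis by (simp add: c_def card_Diff_singleton)
    qed
    show ?thesis
      unfolding m_def using R_pos
      by (subst prod, simp add: x_def)+ (auto simp: prod x_def y_def g_def corner_def hat_def)
  qed
  have mM: "m \<in> Mol"
    unfolding m_def by (rule Mol_diff[OF interp_Mol[OF xc] interp_Mol[OF yc]])
  define F where "F = range (corner R w) - {b}"
  have "z \<in> F" if "m z \<noteq> 0" for z
  proof -
    have "interp x z \<noteq> 0 \<or> interp y z \<noteq> 0" using that by (auto simp: m_def)
    then have "z \<noteq> b" "z \<in> range (corner R w)"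
      using interp_support[OF xc, of z] interp_support[OF yc, of z]
        grid_cube_vertices_iff[OF R_pos, of z w] grid_cube_vertices_eq[OF R_pos, of w] by auto
    then show ?thesis by (simp add: F_def)
  qed
  then have F: "finite F" "{z. m z \<noteq> 0} \<subseteq> F" "b \<notin> F" by (auto simp: F_def)
  have g_abs: "\<bar>g A\<bar> powr p = c powr p" for A by (simp add: g_def c_def)
  have cardU: "card (UNIV :: 'n set set) = 2 ^ CARD('n)"
    using card_Pow[of "UNIV :: 'n set"] by simp
  \<comment> \<open>Toggling membership of \<open>i0\<close> is a sign-reversing involution.\<close>
  have "sum g UNIV = (\<Sum>A\<in>UNIV. - g A)"
    by (rule sum.reindex_bij_witness[where i = "\<lambda>A. if i0 \<in> A then A - {i0} else insert i0 A"
          and j = "\<lambda>A. if i0 \<in> A then A - {i0} else insert i0 A"]) (auto simp: g_def)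
  then have g_sum: "sum g UNIV = 0" by (simp add: sum_negf)
  \<comment> \<open>If \<open>b\<close> is a vertex of the cube, its coefficient is missing from
    \<open>m\<close>; since \<open>g\<close> sums to zero, the total-mass term restores exactly this
    contribution. Otherwise all vertices are present in the first sum.\<close>
  have "2 ^ CARD('n) * c powr p \<le> (\<Sum>z\<in>F. \<bar>m z\<bar> powr p) + \<bar>\<Sum>z\<in>F. m z\<bar> powr p"
  proof (cases "b \<in> range (corner R w)")
    case False
    then have "(\<Sum>z\<in>F. \<bar>m z\<bar> powr p) = (\<Sum>A\<in>UNIV. \<bar>m (corner R w A)\<bar> powr p)"
      using sum.reindex[OF inj_corner[OF R_pos], of "\<lambda>z. \<bar>m z\<bar> powr p" w] by (simp add: F_def)
    also have "\<dots> = (\<Sum>A\<in>(UNIV :: 'n set set). c powr p)"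
      using False by (intro sum.cong refl) (metis m_corner g_abs rangeI)
    finally show ?thesis by (simp add: cardU)
  next
    case True
    then obtain A0 where A0: "b = corner R w A0" by blast
    have Feq: "F = corner R w ` (UNIV - {A0})"
      using inj_corner[OF R_pos, of w] by (auto simp: F_def A0 inj_def)
    have inj: "inj_on (corner R w) (UNIV - {A0})"
      using inj_corner[OF R_pos] by (rule inj_on_subset) simp
    have mA: "m (corner R w A) = g A" if "A \<in> UNIV - {A0}" for A
      using that inj_corner[OF R_pos, of w] m_corner[of A] by (auto simp: A0 inj_def)
    have "(\<Sum>z\<in>F. m z) = sum g (UNIV - {A0})"
      unfolding Feq using mA by (simp add: sum.reindex[OF inj])
    also have "\<dots> = - g A0"
      using g_sum by (simp add: sum_diff1)
    finally have "\<bar>\<Sum>z\<in>F. m z\<bar> powr p = c powr p"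
      by (simp add: g_abs)
    moreover have "(\<Sum>z\<in>F. \<bar>m z\<bar> powr p) = (\<Sum>A\<in>UNIV - {A0}. c powr p)"
      unfolding Feq sum.reindex[OF inj] o_def using mA by (intro sum.cong refl) (simp add: g_abs)
    moreover have "(\<Sum>A\<in>UNIV - {A0}. c powr p) + c powr p = (\<Sum>A\<in>(UNIV :: 'n set set). c powr p)"
      using sum.remove[of UNIV A0 "\<lambda>A. c powr p"] by (simp add: add.commute)
    ultimately show ?thesis by (simp add: cardU)
  qed
  also have "\<dots> \<le> 2 / R powr p * N m powr p"
    by (rule coefficient_bound[OF mM F R_pos l1_dist_V_ge])
  \<comment> \<open>The factor 2 of \<open>coefficient_bound\<close> lowers the exponent from
    \<open>d\<close> to \<open>d - 1\<close>.\<close>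
  finally have "2 ^ (CARD('n) - 1) * c powr p * R powr p \<le> N m powr p"
    using R_pos power_Suc[of "2::real" "CARD('n) - 1"] by (simp add: field_simps)
  also have "2 ^ (CARD('n) - 1) * c powr p * R powr p = (C_const p (2 ^ (CARD('n) - 1)) * R) powr p"
  proof -
    have "2 ^ (CARD('n) - 1) * c powr p = (2 ^ (CARD('n) - 1)) powr (1 - p)"
      by (simp add: c_def powr_diff powr_divide power_one_over inverse_eq_divide)
    then show ?thesis
      using R_pos by (simp add: powr_mult C_const_nonneg C_const_powr p_gt_0)
  qed
  finally have "C_const p (2 ^ (CARD('n) - 1)) * R \<le> N m"
    by (rule powr_p_le_cancel[OF pnorm_ge_0[OF mM]])
  moreover have "x \<in> K" "y \<in> K" using xc yc w by (auto simp: K_iff)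
  moreover have "x \<noteq> y" using dist R_pos by auto
  ultimately show ?thesis
    using that dist by (simp add: m_def)
qed

lemma free_Lip_bounds:
  assumes "is_vertex_interpolation p V b K \<R> r"
  shows "ereal (C_const p (2 ^ (CARD('n) - 1))) \<le> free_Lip p l1_dist V b K r"
    and "free_Lip p l1_dist V b K r \<le> ereal (C_const p (2 ^ (CARD('n) - 1)) * C_const p CARD('n) * C_const p 3)"
proof -
  obtain x y where xy: "x \<in> K" "y \<in> K" "x \<noteq> y"
    "C_const p (2 ^ (CARD('n) - 1)) * l1_dist x y \<le> N (\<lambda>z. interp x z - interp y z)"
    by (rule lower_bound)
  then have "C_const p (2 ^ (CARD('n) - 1)) \<le> N (\<lambda>z. interp x z - interp y z) / l1_dist x y"
    using l1_dist_pos[OF xy(3)] by (simp add: pos_le_divide_eq)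
  then show "ereal (C_const p (2 ^ (CARD('n) - 1))) \<le> free_Lip p l1_dist V b K r"
    unfolding free_Lip_eq[OF assms] using xy(1-3) by (intro SUP_upper2[of "(x, y)"]) auto
  show "free_Lip p l1_dist V b K r \<le> ereal (C_const p (2 ^ (CARD('n) - 1)) * C_const p CARD('n) * C_const p 3)"
    unfolding free_Lip_eq[OF assms]
  proof (rule SUP_least, clarify)
    fix x y assume x: "x \<in> K" and y: "y \<in> K" and neq: "x \<noteq> y"
    have "N (\<lambda>z. interp x z - interp y z) / l1_dist x y
        \<le> C_const p (2 ^ (CARD('n) - 1)) * C_const p CARD('n) * C_const p 3"
      using upper_bound[OF x y] l1_dist_pos[OF neq] by (simp only: pos_divide_le_eq)
    then show "ereal (N (\<lambda>z. interp x z - interp y z) / l1_dist x y)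
        \<le> ereal (C_const p (2 ^ (CARD('n) - 1)) * C_const p CARD('n) * C_const p 3)"
      by simp
  qed
qed

end

theorem theoremB:
  fixes R p :: real
    and \<R> :: "(real ^ 'n) set set"
    and K V :: "(real ^ 'n) set"
    and b :: "real ^ 'n"
  assumes "R > 0" and "0 < p" and "p \<le> 1"
    and "\<R> \<noteq> {}" and "\<R> \<subseteq> range (grid_cube R)"
    and "K = \<Union>\<R>" and "V = vertices_of R \<R>" and "b \<in> V"
  shows "(\<exists>!r. is_vertex_interpolation p V b K \<R> r) \<and>
         (\<forall>r. is_vertex_interpolation p V b K \<R> r \<longrightarrow>
            ereal (C_const p (2 ^ (CARD('n) - 1))) \<le> free_Lip p l1_dist V b K r \<and>
            free_Lip p l1_dist V b K r
              \<le> ereal (C_const p (2 ^ (CARD('n) - 1)) * C_const p CARD('n) * C_const p 3))"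
proof -
  interpret cube_grid R p \<R> K V b
    using assms by unfold_locales
  show ?thesis
    using ex1_interpolation free_Lip_bounds by blast
qed

end
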